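(* Consider the noiseless model with $\lim_{n\to\infty}N_0(n)=\infty$, and assume (G1) and (G2). Let $\ell_n<0$ with $\ell_n\to\ell<0$. Then $\mathcal V_n(\ell_n)$ converges weakly, as $n\to\infty$, to the law of $$\sum_{j=0}^\infty\Big(2\sum_{i=j}^\infty\lambda_iE_i\Big)^{1/2}\mathbf 1_{\{Z(\ell)=j\}}.$$ Here $E_0,E_1,\dots$ are i.i.d. mean-one exponentials, and $Z(\ell)\ge0$ is an integer-valued random variable independent of them with $P(Z(\ell)=j)=p_j(\ell):=\lim_{n\to\infty}p_j(n,\ell_n)$; these limits exist for each $j\ge0$.
   Context: **Discrete processes with memory.** Fix $n\ge2$ and let $\mathcal D_n=\{0,\dots,n\}$, with reals $v_j(n)$ and rate functions $a_{ij}:\mathbb R\to[0,\infty)$. The process $(X_n,L_n)$ on $\mathcal D_n\times\mathbb R$ is built as follows. - Set $T_0=0$. - If $X_n(T_k)=x$ and $L_n(T_k)=y$, let $T^j_{k+1}=\inf\{t>T_k:\int_{T_k}^ta_{xj}(y+v_x(n)(s-T_k))ds\ge E^j_k\}$, with $E^j_k$ i.i.d. mean-one exponentials. Let $T_{k+1}=\min_jT^j_{k+1}$. - On $[T_k,T_{k+1})$, $X_n=x$ and $L_n(s)=y+v_x(n)(s-T_k)$; then $X_n(T_{k+1})$ is the minimizing $j$. **Noiseless model.** There are integers $0\le N_0(n),N_1(n)<n/2$ with $N_k(n)/n\to0$. - Boundary layers: $\partial\mathcal D_n^-=\{0,\dots,N_0(n)\}$ and $\partial\mathcal D_n^+=\{n-N_1(n),\dots,n\}$.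 - Memory rates: $v_j(n)>0$ on $\partial\mathcal D_n^-$, $<0$ on $\partial\mathcal D_n^+$, and $0$ elsewhere, with $\sum_{j=0}^{N_0(n)}v_j(n)=\sum_{j=0}^{N_1(n)}|v_{n-j}(n)|=n$. - Jump rates: $a_{ij}\equiv0$ for $|i-j|\ne1$, and $a_{i,i+1}(\ell)=c_i(n)\max(\ell,0)$, $a_{i+1,i}(\ell)=c_i(n)\max(-\ell,0)$ for $0\le i\le n-1$, where - $c_i(n)=\sum_{m=0}^iv_m(n)$ for $i\le N_0(n)$, - $c_i(n)=n$ for $N_0(n)\le i\le n-N_1(n)-1$, - $c_{n-1-i}(n)=\sum_{m=0}^i|v_{n-m}(n)|$ for $0\le i\le N_1(n)$. - Ratios: $\lambda_i(n)=v_i(n)/c_i(n)$ for $0\le i\le N_0(n)$, and $\mu_i(n)=v_{i+1}(n)/c_i(n)$ for $0\le i<N_0(n)$. For $j\ge0$ set $\lambda'_j(n)=\lambda_j(n)$ if $j\le N_0(n)$ and $0$ otherwise; set $\mu'_j(n)=\mu_j(n)$ if $j\le N_0(n)-1$ and $0$ otherwise. - Conditions: - (G1): $\sum_{j\ge0}|\mu'_j(n)-\mu_j|\to0$ for some sequence $(\mu_j)_{j\ge0}$; - (G2): $\sum_{j\ge0}|\lambda'_j(n)-\lambda_j|\to0$ for some sequence $(\lambda_j)_{j\ge0}$. **Reversal and exit quantities.** Start from $X_n(0)=N_0(n)$, $L_n(0)=\ell<0$. Let $\mathcal T_n=\inf\{t\ge0:L_n(t)\ge0\}$, $G_n=X_n(\mathcal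 T_n)$, $\mathcal U_n=\inf\{t\ge\mathcal T_n:X_n(t)\notin\partial\mathcal D_n^-\}$, and $p_j(n,\ell)=P(G_n=j)$. Let $\mathcal V_n(\ell)$ be the law of $L_n(\mathcal U_n)$. *)

theory Defs
  imports "HOL-Probability.Probability"
begin

text \<open>Mean-one exponential law, and the sample space carrying the i.i.d. family
  omega k j = E^j_k (k = jump number, j = candidate target state).\<close>

definition Exp1 :: "real measure" where
  "Exp1 = density lborel (exponential_density 1)"

definition Omega :: "(nat \<Rightarrow> nat \<Rightarrow> real) measure" where
  "Omega = PiM UNIV (\<lambda>k. PiM UNIV (\<lambda>j. Exp1))"

text \<open>v x = v_x(n), a x j l = a_{xj}(l). Starting at (x,y) with exponential e,
  the (relative) candidate time to jump to j; infinity if the threshold is never reached.\<close>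

definition hit_time ::
  "(nat \<Rightarrow> real) \<Rightarrow> (nat \<Rightarrow> nat \<Rightarrow> real \<Rightarrow> real) \<Rightarrow> nat \<Rightarrow> real \<Rightarrow> nat \<Rightarrow> real \<Rightarrow> ereal" where
  "hit_time v a x y j e =
     Inf (ereal ` {s. 0 < s \<and> e \<le> integral {0..s} (\<lambda>r. a x j (y + v x * r))})"

text \<open>One jump: state (X(T_k), L(T_k), T_k) and exponentials e j = E^j_k give
  (X(T_{k+1}), L(T_{k+1}), T_{k+1}).  Ties (probability zero) go to the least index.\<close>

definition jump_step ::
  "nat \<Rightarrow> (nat \<Rightarrow> real) \<Rightarrow> (nat \<Rightarrow> nat \<Rightarrow> real \<Rightarrow> real) \<Rightarrow> nat \<times> real \<times> ereal
     \<Rightarrow> (nat \<Rightarrow> real) \<Rightarrow> nat \<times> real \<times> ereal" where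
  "jump_step n v a st e = (case st of (x, y, T) \<Rightarrow>
     let \<tau> = (\<lambda>j. hit_time v a x y j (e j));
         m = Min (\<tau> ` {..n});
         j = (LEAST j. j \<le> n \<and> \<tau> j = m)
     in (j, y + v x * real_of_ereal m, T + m))"

primrec chain ::
  "nat \<Rightarrow> (nat \<Rightarrow> real) \<Rightarrow> (nat \<Rightarrow> nat \<Rightarrow> real \<Rightarrow> real) \<Rightarrow> nat \<Rightarrow> real
     \<Rightarrow> (nat \<Rightarrow> nat \<Rightarrow> real) \<Rightarrow> nat \<Rightarrow> nat \<times> real \<times> ereal" where
  "chain n v a x0 y0 \<omega> 0 = (x0, y0, 0)"
| "chain n v a x0 y0 \<omega> (Suc k) = jump_step n v a (chain n v a x0 y0 \<omega> k) (\<omega> k)"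

definition jump_index ::
  "nat \<Rightarrow> (nat \<Rightarrow> real) \<Rightarrow> (nat \<Rightarrow> nat \<Rightarrow> real \<Rightarrow> real) \<Rightarrow> nat \<Rightarrow> real
     \<Rightarrow> (nat \<Rightarrow> nat \<Rightarrow> real) \<Rightarrow> real \<Rightarrow> nat" where
  "jump_index n v a x0 y0 \<omega> t =
     (LEAST k. ereal t < snd (snd (chain n v a x0 y0 \<omega> (Suc k))))"

definition Xproc ::
  "nat \<Rightarrow> (nat \<Rightarrow> real) \<Rightarrow> (nat \<Rightarrow> nat \<Rightarrow> real \<Rightarrow> real) \<Rightarrow> nat \<Rightarrow> real
     \<Rightarrow> (nat \<Rightarrow> nat \<Rightarrow> real) \<Rightarrow> real \<Rightarrow> nat" where
  "Xproc n v a x0 y0 \<omega> t = fst (chain n v a x0 y0 \<omega> (jump_index n v a x0 y0 \<omega> t))"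

definition Lproc ::
  "nat \<Rightarrow> (nat \<Rightarrow> real) \<Rightarrow> (nat \<Rightarrow> nat \<Rightarrow> real \<Rightarrow> real) \<Rightarrow> nat \<Rightarrow> real
     \<Rightarrow> (nat \<Rightarrow> nat \<Rightarrow> real) \<Rightarrow> real \<Rightarrow> real" where
  "Lproc n v a x0 y0 \<omega> t = (case chain n v a x0 y0 \<omega> (jump_index n v a x0 y0 \<omega> t) of
     (x, y, T) \<Rightarrow> y + v x * (t - real_of_ereal T))"

definition rev_time ::
  "nat \<Rightarrow> (nat \<Rightarrow> real) \<Rightarrow> (nat \<Rightarrow> nat \<Rightarrow> real \<Rightarrow> real) \<Rightarrow> nat \<Rightarrow> real
     \<Rightarrow> (nat \<Rightarrow> nat \<Rightarrow> real) \<Rightarrow> real" where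
  "rev_time n v a x0 y0 \<omega> = Inf {t. 0 \<le> t \<and> 0 \<le> Lproc n v a x0 y0 \<omega> t}"

definition exit_time ::
  "nat \<Rightarrow> (nat \<Rightarrow> real) \<Rightarrow> (nat \<Rightarrow> nat \<Rightarrow> real \<Rightarrow> real) \<Rightarrow> nat \<Rightarrow> real
     \<Rightarrow> nat set \<Rightarrow> (nat \<Rightarrow> nat \<Rightarrow> real) \<Rightarrow> real" where
  "exit_time n v a x0 y0 B \<omega> =
     Inf {t. rev_time n v a x0 y0 \<omega> \<le> t \<and> Xproc n v a x0 y0 \<omega> t \<notin> B}"

text \<open>c_i(n), for 0 \<le> i \<le> n-1 (here N0 = N_0(n), N1 = N_1(n), v = v_.(n)).\<close>
definition cN :: "nat \<Rightarrow> nat \<Rightarrow> nat \<Rightarrow> (nat \<Rightarrow> real) \<Rightarrow> nat \<Rightarrow> real" where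
  "cN n N0 N1 v i =
     (if i \<le> N0 then (\<Sum>m\<le>i. v m)
      else if n - N1 - 1 \<le> i then (\<Sum>m\<le>n - 1 - i. \<bar>v (n - m)\<bar>)
      else real n)"

definition rateN :: "nat \<Rightarrow> nat \<Rightarrow> nat \<Rightarrow> (nat \<Rightarrow> real) \<Rightarrow> nat \<Rightarrow> nat \<Rightarrow> real \<Rightarrow> real" where
  "rateN n N0 N1 v i j l =
     (if j = Suc i \<and> i < n then cN n N0 N1 v i * max l 0
      else if i = Suc j \<and> j < n then cN n N0 N1 v j * max (- l) 0
      else 0)"

definition lamN :: "nat \<Rightarrow> nat \<Rightarrow> nat \<Rightarrow> (nat \<Rightarrow> real) \<Rightarrow> nat \<Rightarrow> real" where
  "lamN n N0 N1 v j = (if j \<le> N0 then v j / cN n N0 N1 v j else 0)"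

definition muN :: "nat \<Rightarrow> nat \<Rightarrow> nat \<Rightarrow> (nat \<Rightarrow> real) \<Rightarrow> nat \<Rightarrow> real" where
  "muN n N0 N1 v j = (if j + 1 \<le> N0 then v (j + 1) / cN n N0 N1 v j else 0)"

definition pN :: "nat \<Rightarrow> nat \<Rightarrow> nat \<Rightarrow> (nat \<Rightarrow> real) \<Rightarrow> real \<Rightarrow> nat \<Rightarrow> real" where
  "pN n N0 N1 v l j = measure Omega
     {\<omega> \<in> space Omega.
        Xproc n v (rateN n N0 N1 v) N0 l \<omega> (rev_time n v (rateN n N0 N1 v) N0 l \<omega>) = j}"

definition VN :: "nat \<Rightarrow> nat \<Rightarrow> nat \<Rightarrow> (nat \<Rightarrow> real) \<Rightarrow> real \<Rightarrow> real measure" where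
  "VN n N0 N1 v l = distr Omega borel
     (\<lambda>\<omega>. Lproc n v (rateN n N0 N1 v) N0 l \<omega>
             (exit_time n v (rateN n N0 N1 v) N0 l {..N0} \<omega>))"

definition OmegaE :: "(nat \<Rightarrow> real) measure" where
  "OmegaE = PiM UNIV (\<lambda>i. Exp1)"

end

(* While L < 0 the process steps down the boundary layer, and the jump from i + 1 to i lowers L^2 by
   2 mu_i e, with e the exponential clock of that jump; while L > 0 it steps up, and the jump from i to
   i + 1 raises L^2 by 2 lambda_i e. Hence G_n <= j iff 2 sum_{i >= j} mu_i(n) E_i <= ell_n^2, and given
   G_n = j the memory at exit is (2 sum_{i >= j} lambda_i(n) E'_i)^(1/2) with clocks E' independent of
   those deciding G_n. Under (G1) and (G2) these sums converge in L^1 to the limiting ones, whose laws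
   have no atom away from 0, so P(G_n <= j) converges; no mass escapes because the tails of the limiting
   mu-series vanish. *)
theory Submission
  imports Defs
begin

text \<open>The probability space carries a doubly indexed array of clocks, and which entries are
  read depends on the path: the descent to \<open>i\<close> reads row \<open>N0 - 1 - i\<close>,
  while the ascent from \<open>i\<close> reads row \<open>N0 + i - 2 * G\<close>, which moves with
  the random level \<open>G\<close>. Independence is therefore used only after fixing
  \<open>G = j\<close>: up to a null set that event is a function of the descent clocks, whose
  positions are disjoint from the ascent positions for this \<open>j\<close>. Any injective choice
  of positions has the law \<open>OmegaE\<close>, so the sums for all n can be placed on one
  sequence of clocks and compared in L^1. Measurability has to come first: \<open>pN\<close> and
  \<open>VN\<close> are built with \<open>measure\<close> and \<open>distr\<close>, whose values say
  nothing on nonmeasurable input. Squares are the right scale because a rate is proportional to the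
  memory, itself affine in time: cumulative intensity is a change of a squared positive part,
  divided by 2 mu or 2 lambda. Finally, \<open>l < 0\<close> keeps the threshold
  \<open>l^2 / 2\<close> away from 0, the only possible atom of a weighted sum.\<close>

section \<open>Measurability of the process\<close>

text \<open>For a nonempty set bounded below, \<open>Inf < c\<close> holds iff some element is below
  \<open>c\<close>. The infimum of the empty real set is a fixed unspecified number, so nonemptiness
  is split off as an event of its own, a countable union over natural bounds.\<close>

lemma measurable_Inf_real:
  fixes P :: "'a \<Rightarrow> real \<Rightarrow> bool" and m :: "'a \<Rightarrow> real"
  assumes lower: "\<And>\<omega> t. \<omega> \<in> space M \<Longrightarrow> P \<omega> t \<Longrightarrow> m \<omega> \<le> t"
    and meas: "\<And>c. Measurable.pred M (\<lambda>\<omega>. \<exists>t<c. P \<omega> t)"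
  shows "(\<lambda>\<omega>. Inf {t. P \<omega> t}) \<in> borel_measurable M"
proof -
  have "Measurable.pred M (\<lambda>\<omega>. \<exists>n::nat. \<exists>t<real n. P \<omega> t)"
    using meas by simp
  also have "(\<lambda>\<omega>. \<exists>n::nat. \<exists>t<real n. P \<omega> t) = (\<lambda>\<omega>. \<exists>t. P \<omega> t)"
    using reals_Archimedean2 by (intro ext) blast
  finally have ex [measurable]: "Measurable.pred M (\<lambda>\<omega>. \<exists>t. P \<omega> t)" .
  have "Measurable.pred M (\<lambda>\<omega>. Inf {t. P \<omega> t} < c)" for c
  proof -
    note meas[of c, measurable]
    have "Inf {t. P \<omega> t} < c \<longleftrightarrow> (if \<exists>t. P \<omega> t then \<exists>t<c. P \<omega> t else Inf ({}::real set) < c)"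
      if "\<omega> \<in> space M" for \<omega>
    proof (cases "\<exists>t. P \<omega> t")
      case True
      moreover have "bdd_below {t. P \<omega> t}"
        using lower[OF that] by (intro bdd_belowI[of _ "m \<omega>"]) auto
      ultimately show ?thesis
        by (subst cInf_less_iff) auto
    qed auto
    then show ?thesis
      by (subst measurable_cong) (assumption, measurable)
  qed
  then show ?thesis
    by (subst borel_measurable_iff_less) (auto simp: pred_def)
qed

text \<open>An affine function is nonnegative somewhere on an interval \<open>[A, B)\<close> iff it is
  nonnegative at \<open>A\<close> or positive at \<open>B\<close>; this turns the quantifier over \<open>t\<close> into a measurable condition.\<close>
lemma pred_ex_affine_nonneg:
  fixes a b :: "'a \<Rightarrow> ereal" and r p q :: "'a \<Rightarrow> real"
  assumes [measurable]: "a \<in> borel_measurable M" "b \<in> borel_measurable M"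
    "r \<in> borel_measurable M" "p \<in> borel_measurable M" "q \<in> borel_measurable M"
  shows "Measurable.pred M
    (\<lambda>\<omega>. \<exists>t<c. r \<omega> \<le> t \<and> a \<omega> \<le> ereal t \<and> ereal t < b \<omega> \<and> 0 \<le> p \<omega> + q \<omega> * t)"
proof -
  \<comment> \<open>Absorbing the bounds \<open>r\<close> and \<open>c\<close> into the endpoints
    leaves one interval \<open>[A, B)\<close> whose endpoints are real whenever it is
    nonempty.\<close>
  define A where "A \<omega> = max (ereal (r \<omega>)) (a \<omega>)" for \<omega>
  define B where "B \<omega> = min (ereal c) (b \<omega>)" for \<omega>
  have [measurable]: "A \<in> borel_measurable M" "B \<in> borel_measurable M"
    unfolding A_def B_def by measurable
  have *: "(\<exists>t<c. r \<omega> \<le> t \<and> a \<omega> \<le> ereal t \<and> ereal t < b \<omega> \<and> 0 \<le> p \<omega> + q \<omega> * t) \<longleftrightarrow>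
    A \<omega> < B \<omega> \<and> (0 \<le> p \<omega> + q \<omega> * real_of_ereal (A \<omega>) \<or> 0 < p \<omega> + q \<omega> * real_of_ereal (B \<omega>))"
    for \<omega>
  proof -
    have **: "(\<exists>t<c. r \<omega> \<le> t \<and> a \<omega> \<le> ereal t \<and> ereal t < b \<omega> \<and> 0 \<le> p \<omega> + q \<omega> * t) \<longleftrightarrow>
       (\<exists>t. A \<omega> \<le> ereal t \<and> ereal t < B \<omega> \<and> 0 \<le> p \<omega> + q \<omega> * t)"
      unfolding A_def B_def by auto
    show ?thesis
    proof (cases "A \<omega> < B \<omega>")
      case False
      then have "\<not> (A \<omega> \<le> ereal t \<and> ereal t < B \<omega>)" for t
        by (auto dest: le_less_trans)
      with False show ?thesis unfolding ** by blast
    next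
      case True
      have "A \<omega> \<noteq> -\<infinity>" "B \<omega> \<noteq> \<infinity>"
        unfolding A_def B_def by (auto simp: max_def min_def split: if_splits)
      with True obtain x y where xy: "A \<omega> = ereal x" "B \<omega> = ereal y" "x < y"
        by (cases "A \<omega>"; cases "B \<omega>") auto
      have "(\<exists>t. x \<le> t \<and> t < y \<and> 0 \<le> p \<omega> + q \<omega> * t) \<longleftrightarrow> 0 \<le> p \<omega> + q \<omega> * x \<or> 0 < p \<omega> + q \<omega> * y"
      proof
        assume "\<exists>t. x \<le> t \<and> t < y \<and> 0 \<le> p \<omega> + q \<omega> * t"
        then obtain t where t: "x \<le> t" "t < y" "0 \<le> p \<omega> + q \<omega> * t" by auto
        show "0 \<le> p \<omega> + q \<omega> * x \<or> 0 < p \<omega> + q \<omega> * y"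
        proof (cases "q \<omega> > 0")
          case True
          then have "q \<omega> * t < q \<omega> * y" using t by simp
          then show ?thesis using t by linarith
        next
          case False
          then have "q \<omega> * t \<le> q \<omega> * x" using t by (intro mult_left_mono_neg) auto
          then show ?thesis using t by linarith
        qed
      next
        assume "0 \<le> p \<omega> + q \<omega> * x \<or> 0 < p \<omega> + q \<omega> * y"
        then show "\<exists>t. x \<le> t \<and> t < y \<and> 0 \<le> p \<omega> + q \<omega> * t"
        proof
          assume "0 < p \<omega> + q \<omega> * y"
          moreover have "((\<lambda>t. p \<omega> + q \<omega> * t) \<longlongrightarrow> p \<omega> + q \<omega> * y) (at_left y)"
            by (intro tendsto_intros)
          ultimately have "\<forall>\<^sub>F t in at_left y. 0 < p \<omega> + q \<omega> * t"
            by (rule order_tendstoD(1)[rotated])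
          moreover have "\<forall>\<^sub>F t in at_left y. t \<in> {x<..<y}"
            using \<open>x < y\<close> by (rule eventually_at_left_real)
          ultimately have "\<forall>\<^sub>F t in at_left y. 0 < p \<omega> + q \<omega> * t \<and> t \<in> {x<..<y}"
            by (rule eventually_conj)
          then obtain t where "0 < p \<omega> + q \<omega> * t" "t \<in> {x<..<y}"
            using eventually_happens trivial_limit_at_left_real by blast
          then show ?thesis by (intro exI[of _ t]) auto
        qed (use \<open>x < y\<close> in auto)
      qed
      then show ?thesis unfolding ** using xy by auto
    qed
  qed
  show ?thesis unfolding * by measurable
qed

text \<open>A parameter integral of a jointly continuous integrand over a compact interval is
  continuous in the starting value.\<close>

lemma borel_measurable_integral_affine:
  fixes g :: "real \<Rightarrow> real"
  assumes "continuous_on UNIV g" and f: "f \<in> borel_measurable M"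
  shows "(\<lambda>\<omega>. integral {0..s} (\<lambda>r. g (f \<omega> + w * r))) \<in> borel_measurable M"
proof -
  have "continuous_on UNIV (\<lambda>y. integral (cbox 0 s) (\<lambda>r. g (y + w * r)))"
  proof (rule integral_continuous_on_param)
    have "continuous_on (UNIV \<times> cbox 0 s) (\<lambda>z::real\<times>real. fst z + w * snd z)"
      by (intro continuous_intros)
    from continuous_on_compose2[OF assms(1) this] 
    show "continuous_on (UNIV \<times> cbox 0 s) (\<lambda>(y, r). g (y + w * r))"
      by (simp add: split_beta)
  qed
  then have "(\<lambda>y. integral {0..s} (\<lambda>r. g (y + w * r))) \<in> borel_measurable borel"
    by (simp add: borel_measurable_continuous_onI)
  from measurable_compose[OF f this] show ?thesis .
qed

text \<open>A nonnegative rate makes the cumulative intensity \<open>F\<close> monotone in time, so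
  a time below \<open>c\<close> at which the threshold is passed can be replaced by a slightly later
  rational one. The event \<open>hit_time < c\<close> is then a countable union.\<close>

lemma borel_measurable_hit_time:
  assumes cont: "continuous_on UNIV (a x j)" and nonneg: "\<And>l. 0 \<le> a x j l"
    and f: "f \<in> borel_measurable M" and g: "g \<in> borel_measurable M"
  shows "(\<lambda>\<omega>. hit_time v a x (f \<omega>) j (g \<omega>)) \<in> borel_measurable M"
proof (rule borel_measurableI_less)
  fix c :: ereal
  define F where "F s \<omega> = integral {0..s} (\<lambda>r. a x j (f \<omega> + v x * r))" for s \<omega>
  have F[measurable]: "F s \<in> borel_measurable M" for s
    unfolding F_def by (rule borel_measurable_integral_affine[OF cont f])
  have mono: "F s \<omega> \<le> F t \<omega>" if "s \<le> t" for s t \<omega>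
  proof -
    have "continuous_on A (\<lambda>r. f \<omega> + v x * r)" for A
      by (intro continuous_intros)
    from continuous_on_compose2[OF cont this]
    have "(\<lambda>r. a x j (f \<omega> + v x * r)) integrable_on {0..u}" for u
      by (intro integrable_continuous_interval) auto
    then show ?thesis
      unfolding F_def using that nonneg by (intro integral_subset_le) auto
  qed
  define Q where "Q = {q \<in> \<rat>. 0 < q \<and> ereal q < c}"
  have "hit_time v a x (f \<omega>) j (g \<omega>) < c \<longleftrightarrow> (\<exists>q\<in>Q. g \<omega> \<le> F q \<omega>)" for \<omega>
  proof
    assume "hit_time v a x (f \<omega>) j (g \<omega>) < c"
    then obtain s where s: "0 < s" "g \<omega> \<le> F s \<omega>" "ereal s < c"
      unfolding hit_time_def Inf_less_iff F_def by blast
    obtain z where z: "s < z" "ereal z < c" using ereal_dense2[OF s(3)] by auto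
    from Rats_dense_in_real[OF z(1)] obtain q where q: "q \<in> \<rat>" "s < q" "q < z" by auto
    have "g \<omega> \<le> F q \<omega>" using s mono[of s q \<omega>] q by auto
    moreover have "q \<in> Q"
      using q z(2) less_trans[of "ereal q" "ereal z" c] s by (simp add: Q_def)
    ultimately show "\<exists>q\<in>Q. g \<omega> \<le> F q \<omega>" by blast
  next
    assume "\<exists>q\<in>Q. g \<omega> \<le> F q \<omega>"
    then obtain q where q: "0 < q" "ereal q < c" "g \<omega> \<le> F q \<omega>"
      by (auto simp: Q_def)
    then have "ereal q \<in> ereal ` {s. 0 < s \<and> g \<omega> \<le> F s \<omega>}"
      by (intro imageI CollectI conjI)
    from bexI[of "\<lambda>x. x < c", OF q(2) this] show "hit_time v a x (f \<omega>) j (g \<omega>) < c"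
      unfolding hit_time_def Inf_less_iff F_def .
  qed
  moreover have "{\<omega> \<in> space M. \<exists>q\<in>Q. g \<omega> \<le> F q \<omega>} \<in> sets M"
  proof (rule sets.sets_Collect_countable_Ex')
    show "countable Q"
      by (rule countable_subset[OF _ countable_rat]) (auto simp: Q_def)
    show "{\<omega> \<in> space M. g \<omega> \<le> F q \<omega>} \<in> sets M" for q
      using g by measurable
  qed
  ultimately show "{\<omega> \<in> space M. hit_time v a x (f \<omega>) j (g \<omega>) < c} \<in> sets M"
    by simp
qed

lemma space_Exp1 [simp]: "space Exp1 = UNIV" and sets_Exp1 [simp, measurable_cong]: "sets Exp1 = sets borel"
  by (simp_all add: Exp1_def)

lemma space_Omega [simp]: "space Omega = UNIV"
  by (auto simp: Omega_def space_PiM PiE_def)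

lemma measurable_Omega_component [measurable]: "(\<lambda>\<omega>. \<omega> k j) \<in> borel_measurable Omega"
proof -
  have "(\<lambda>\<omega>. \<omega> k) \<in> measurable Omega (PiM UNIV (\<lambda>j. Exp1))"
    unfolding Omega_def by measurable
  moreover have "(\<lambda>e. e j) \<in> measurable (PiM UNIV (\<lambda>j. Exp1)) Exp1"
    by measurable
  ultimately have "(\<lambda>\<omega>. \<omega> k j) \<in> measurable Omega Exp1"
    by (rule measurable_compose)
  then show ?thesis by (simp cong: measurable_cong_sets)
qed

section \<open>Measurability of the chain, the process and its two stopping times\<close>

context
  fixes n :: nat and v :: "nat \<Rightarrow> real" and a :: "nat \<Rightarrow> nat \<Rightarrow> real \<Rightarrow> real" and x0 :: nat and y0 :: real
  assumes cont: "\<And>x j. continuous_on UNIV (a x j)" and nonneg: "\<And>x j l. 0 \<le> a x j l"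
begin

definition chain_state where "chain_state k \<omega> = fst (chain n v a x0 y0 \<omega> k)"
definition chain_memory where "chain_memory k \<omega> = fst (snd (chain n v a x0 y0 \<omega> k))"
definition chain_time where "chain_time k \<omega> = snd (snd (chain n v a x0 y0 \<omega> k))"
definition candidate where "candidate k j \<omega> = hit_time v a (chain_state k \<omega>) (chain_memory k \<omega>) j (\<omega> k j)"

lemma chain_Suc_components:
  "chain_state (Suc k) \<omega> = (LEAST j. j \<le> n \<and> candidate k j \<omega> = Min ((\<lambda>j. candidate k j \<omega>) ` {..n}))"
  "chain_memory (Suc k) \<omega> = chain_memory k \<omega> + v (chain_state k \<omega>) * real_of_ereal (Min ((\<lambda>j. candidate k j \<omega>) ` {..n}))"
  "chain_time (Suc k) \<omega> = chain_time k \<omega> + Min ((\<lambda>j. candidate k j \<omega>) ` {..n})"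
  unfolding chain_state_def chain_memory_def chain_time_def candidate_def
  by (auto simp: jump_step_def Let_def split: prod.split)

lemma measurable_chain_components:
  "chain_state k \<in> measurable Omega (count_space UNIV)" "chain_memory k \<in> borel_measurable Omega" "chain_time k \<in> borel_measurable Omega"
proof (induction k)
  case 0
  have "chain_state 0 = (\<lambda>\<omega>. x0)" "chain_memory 0 = (\<lambda>\<omega>. y0)" "chain_time 0 = (\<lambda>\<omega>. 0)"
    unfolding chain_state_def[abs_def] chain_memory_def[abs_def] chain_time_def[abs_def] by auto
  then show "chain_state 0 \<in> measurable Omega (count_space UNIV)" "chain_memory 0 \<in> borel_measurable Omega" "chain_time 0 \<in> borel_measurable Omega"
    by simp_all
next
  case (Suc k)
  note IH[measurable] = Suc
  \<comment> \<open>The state takes countably many values, so it may be frozen at a constant; then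
    only the memory and the clock vary in \<open>hit_time\<close>.\<close>
  have candidate[measurable]: "candidate k j \<in> borel_measurable Omega" for j
    unfolding candidate_def[abs_def]
    by (rule measurable_compose_countable[OF _ IH(1)])
       (intro borel_measurable_hit_time cont nonneg IH(2) measurable_Omega_component)
  have v[measurable]: "(\<lambda>\<omega>. v (chain_state k \<omega>)) \<in> borel_measurable Omega"
    by (rule measurable_compose[OF IH(1)]) simp
  define m where "m \<omega> = Min ((\<lambda>j. candidate k j \<omega>) ` {..n})" for \<omega>
  have m[measurable]: "m \<in> borel_measurable Omega"
    unfolding m_def[abs_def] by (intro borel_measurable_Min candidate) auto
  have components: "chain_state (Suc k) = (\<lambda>\<omega>. LEAST j. j \<le> n \<and> candidate k j \<omega> = m \<omega>)"
    "chain_memory (Suc k) = (\<lambda>\<omega>. chain_memory k \<omega> + v (chain_state k \<omega>) * real_of_ereal (m \<omega>))"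
    "chain_time (Suc k) = (\<lambda>\<omega>. chain_time k \<omega> + m \<omega>)"
    by (simp_all add: chain_Suc_components m_def fun_eq_iff)
  have "Measurable.pred Omega (\<lambda>\<omega>. j \<le> n \<and> candidate k j \<omega> = m \<omega>)" for j
    using borel_measurable_eq[OF candidate[of j] m] by (cases "j \<le> n") (simp_all add: pred_def)
  then show "chain_state (Suc k) \<in> measurable Omega (count_space UNIV)"
    unfolding components by (rule measurable_Least)
  show "chain_memory (Suc k) \<in> borel_measurable Omega" "chain_time (Suc k) \<in> borel_measurable Omega"
    unfolding components
    by (intro borel_measurable_add borel_measurable_times borel_measurable_real_of_ereal IH v m
          borel_measurable_ereal_add)+
qed

lemmas [measurable] = measurable_chain_components

lemma measurable_v_chain_state [measurable]: "(\<lambda>\<omega>. v (chain_state k \<omega>)) \<in> borel_measurable Omega"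
  by (rule measurable_compose[OF measurable_chain_components(1)]) simp

lemma process_components:
  "Xproc n v a x0 y0 \<omega> t = chain_state (jump_index n v a x0 y0 \<omega> t) \<omega>"
  "Lproc n v a x0 y0 \<omega> t = chain_memory (jump_index n v a x0 y0 \<omega> t) \<omega> +
     v (chain_state (jump_index n v a x0 y0 \<omega> t) \<omega>) * (t - real_of_ereal (chain_time (jump_index n v a x0 y0 \<omega> t) \<omega>))"
  "jump_index n v a x0 y0 \<omega> t = (LEAST k. ereal t < chain_time (Suc k) \<omega>)"
  unfolding Xproc_def Lproc_def jump_index_def chain_state_def chain_memory_def chain_time_def by (auto split: prod.split)

lemma measurable_jump_index:
  assumes [measurable]: "t \<in> borel_measurable Omega"
  shows "(\<lambda>\<omega>. jump_index n v a x0 y0 \<omega> (t \<omega>)) \<in> measurable Omega (count_space UNIV)"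
  unfolding process_components by measurable

lemma measurable_Xproc:
  assumes "t \<in> borel_measurable Omega"
  shows "(\<lambda>\<omega>. Xproc n v a x0 y0 \<omega> (t \<omega>)) \<in> measurable Omega (count_space UNIV)"
  unfolding process_components(1)
  by (rule measurable_compose_countable[OF _ measurable_jump_index[OF assms]]) measurable

lemma measurable_Lproc:
  assumes [measurable]: "t \<in> borel_measurable Omega"
  shows "(\<lambda>\<omega>. Lproc n v a x0 y0 \<omega> (t \<omega>)) \<in> borel_measurable Omega"
  unfolding process_components(2)
  by (rule measurable_compose_countable[OF _ measurable_jump_index[OF assms]]) measurable

text \<open>\<open>LEAST i. False\<close> is the junk value of the index at times after an explosion.\<close>
lemma jump_index_eq_iff:
  "jump_index n v a x0 y0 \<omega> t = k \<longleftrightarrow>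
    (SUP i\<in>{..<k}. chain_time (Suc i) \<omega>) \<le> ereal t \<and> ereal t < chain_time (Suc k) \<omega> \<or>
    k = (LEAST i. False) \<and> (SUP i. chain_time (Suc i) \<omega>) \<le> ereal t"
proof (cases "\<exists>i. ereal t < chain_time (Suc i) \<omega>")
  case True
  then obtain i where i: "ereal t < chain_time (Suc i) \<omega>" by auto
  have "(LEAST i. ereal t < chain_time (Suc i) \<omega>) = k \<longleftrightarrow> ereal t < chain_time (Suc k) \<omega> \<and> (\<forall>i<k. \<not> ereal t < chain_time (Suc i) \<omega>)"
    by (metis (mono_tags, lifting) LeastI not_less_Least i linorder_neqE_nat)
  then show ?thesis
    unfolding process_components SUP_le_iff using True by (auto simp: not_less) (metis leD)
next
  case False
  then have *: "ereal t < chain_time (Suc i) \<omega> \<longleftrightarrow> False" for i by auto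
  have **: "chain_time (Suc i) \<omega> \<le> ereal t \<longleftrightarrow> True" for i using * by (simp add: not_less)
  show ?thesis
    unfolding process_components SUP_le_iff * ** by auto
qed

text \<open>While the jump index is \<open>k\<close> the path is affine, on the interval before jump
  \<open>k + 1\<close> or on the unbounded one after an explosion, so each \<open>k\<close> is
  settled by \<open>pred_ex_affine_nonneg\<close>. The form covers both stopping times: reversal
  takes the guard \<open>Q\<close> true, exit makes the affine condition trivial.\<close>

lemma pred_ex_process:
  fixes p q :: "nat \<Rightarrow> (nat \<Rightarrow> nat \<Rightarrow> real) \<Rightarrow> real"
  assumes [measurable]: "r \<in> borel_measurable Omega" "\<And>k. p k \<in> borel_measurable Omega" "\<And>k. q k \<in> borel_measurable Omega"
    "\<And>k. Measurable.pred Omega (Q k)"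
  shows "Measurable.pred Omega (\<lambda>\<omega>. \<exists>t<c. r \<omega> \<le> t \<and> (\<exists>k. jump_index n v a x0 y0 \<omega> t = k \<and> Q k \<omega> \<and> 0 \<le> p k \<omega> + q k \<omega> * t))"
proof -
  define P where "P k a b \<omega> \<longleftrightarrow> (\<exists>t<c. r \<omega> \<le> t \<and> a \<omega> \<le> ereal t \<and> ereal t < b \<omega> \<and> 0 \<le> p k \<omega> + q k \<omega> * t)" for k a b \<omega>
  have P[measurable]: "Measurable.pred Omega (P k a b)" if [measurable]: "a \<in> borel_measurable Omega" "b \<in> borel_measurable Omega" for k a b
    unfolding P_def[abs_def] by (rule pred_ex_affine_nonneg) measurable
  have *: "(\<exists>t<c. r \<omega> \<le> t \<and> (\<exists>k. jump_index n v a x0 y0 \<omega> t = k \<and> Q k \<omega> \<and> 0 \<le> p k \<omega> + q k \<omega> * t)) \<longleftrightarrow>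
     (\<exists>k. Q k \<omega> \<and> (P k (\<lambda>\<omega>. SUP i\<in>{..<k}. chain_time (Suc i) \<omega>) (\<lambda>\<omega>. chain_time (Suc k) \<omega>) \<omega> \<or>
       k = (LEAST i. False) \<and> P k (\<lambda>\<omega>. SUP i. chain_time (Suc i) \<omega>) (\<lambda>_. \<infinity>) \<omega>))" for \<omega>
    unfolding jump_index_eq_iff P_def by auto
  show ?thesis
    unfolding * by measurable
qed

lemma measurable_rev_time: "rev_time n v a x0 y0 \<in> borel_measurable Omega"
proof -
  have "rev_time n v a x0 y0 = (\<lambda>\<omega>. Inf {t. 0 \<le> t \<and> (\<exists>k. jump_index n v a x0 y0 \<omega> t = k \<and> True \<and>
     0 \<le> (chain_memory k \<omega> - v (chain_state k \<omega>) * real_of_ereal (chain_time k \<omega>)) + v (chain_state k \<omega>) * t)})"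
    unfolding rev_time_def[abs_def] process_components(2) by (simp add: algebra_simps)
  also have "\<dots> \<in> borel_measurable Omega"
    by (rule measurable_Inf_real[where m="\<lambda>_. 0"], simp, rule pred_ex_process) measurable
  finally show ?thesis .
qed

lemma measurable_exit_time: "exit_time n v a x0 y0 B \<in> borel_measurable Omega"
proof -
  have "exit_time n v a x0 y0 B = (\<lambda>\<omega>. Inf {t. rev_time n v a x0 y0 \<omega> \<le> t \<and>
     (\<exists>k. jump_index n v a x0 y0 \<omega> t = k \<and> chain_state k \<omega> \<notin> B \<and> 0 \<le> 0 + 0 * t)})"
    unfolding exit_time_def[abs_def] process_components(1) by simp
  also have "\<dots> \<in> borel_measurable Omega"
  proof (rule measurable_Inf_real[where m="rev_time n v a x0 y0"], simp, rule pred_ex_process)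
    show "Measurable.pred Omega (\<lambda>\<omega>. chain_state k \<omega> \<notin> B)" for k
      by (rule measurable_compose[OF measurable_chain_components(1)]) simp
  qed (auto intro: measurable_rev_time)
  finally show ?thesis .
qed

end

section \<open>Weighted sums of exponentials\<close>

lemma prob_space_Exp1: "prob_space Exp1"
  unfolding Exp1_def by (rule prob_space_exponential_density) simp

interpretation Exp1: prob_space Exp1
  by (rule prob_space_Exp1)

lemma AE_Exp1_pos: "AE x in Exp1. 0 < x"
proof -
  have "AE x in lborel. x \<noteq> (0::real)"
    by (rule AE_lborel_singleton)
  then show ?thesis
    unfolding Exp1_def by (subst AE_density) (auto simp: exponential_density_def)
qed

lemma emeasure_Exp1_singleton: "emeasure Exp1 {x} = 0"
  unfolding Exp1_def
  by (subst emeasure_density) (auto intro!: nn_integral_0_iff_AE[THEN iffD2] AE_I[of _ _ "{x}"] split: split_indicator)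

text \<open>The exponential density is the Erlang density with index 0 and vanishes on negative
  numbers, so this is an Erlang first moment.\<close>

lemma nn_integral_Exp1_abs: "(\<integral>\<^sup>+x. ennreal \<bar>x\<bar> \<partial>Exp1) = 1"
proof -
  have "(\<integral>\<^sup>+x. ennreal \<bar>x\<bar> \<partial>Exp1) = (\<integral>\<^sup>+x. ennreal (erlang_density 0 1 x * x ^ 1) \<partial>lborel)"
    unfolding Exp1_def
    by (subst nn_integral_density)
       (auto simp: exponential_density_def ennreal_mult[symmetric] intro!: nn_integral_cong)
  also have "\<dots> = 1"
    by (subst nn_integral_erlang_ith_moment) auto
  finally show ?thesis .
qed

interpretation OmegaE: prob_space OmegaE
  unfolding OmegaE_def by (intro prob_space_PiM prob_space_Exp1)

lemma space_OmegaE [simp]: "space OmegaE = UNIV"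
  by (auto simp: OmegaE_def space_PiM PiE_def)

lemma emeasure_OmegaE_UNIV [simp]: "emeasure OmegaE UNIV = 1"
  using OmegaE.emeasure_space_1 by simp

lemma measurable_OmegaE_component [measurable]: "(\<lambda>E. E i) \<in> borel_measurable OmegaE"
proof -
  have "(\<lambda>E. E i) \<in> measurable OmegaE Exp1"
    unfolding OmegaE_def by (rule measurable_component_singleton) simp
  then show ?thesis by (simp cong: measurable_cong_sets)
qed

lemma nn_integral_OmegaE_component:
  assumes "f \<in> borel_measurable borel"
  shows "(\<integral>\<^sup>+E. f (E i) \<partial>OmegaE) = (\<integral>\<^sup>+x. f x \<partial>Exp1)"
proof -
  have "(\<lambda>E. E i) \<in> measurable OmegaE Exp1"
    unfolding OmegaE_def by (rule measurable_component_singleton) simp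
  moreover have "f \<in> borel_measurable Exp1"
    using assms by (simp cong: measurable_cong_sets)
  moreover have "distr OmegaE Exp1 (\<lambda>E. E i) = Exp1"
    unfolding OmegaE_def by (rule distr_PiM_component) (simp_all add: prob_space_Exp1)
  ultimately show ?thesis
    using nn_integral_distr[of "\<lambda>E. E i" OmegaE Exp1 f] by simp
qed

text \<open>A total function of \<open>E\<close>; its value is meaningful only where the series
  converges, which for absolutely summable \<open>b\<close> is almost everywhere by
  \<open>AE_summable_OmegaE\<close>.\<close>

definition expsum :: "(nat \<Rightarrow> real) \<Rightarrow> (nat \<Rightarrow> real) \<Rightarrow> real" where
  "expsum b E = (\<Sum>i. b i * E i)"

lemma measurable_expsum [measurable]: "expsum b \<in> borel_measurable OmegaE"
  unfolding expsum_def[abs_def] by measurable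

lemma nn_integral_suminf_abs_OmegaE:
  assumes "summable (\<lambda>i. \<bar>b i\<bar>)"
  shows "(\<integral>\<^sup>+E. (\<Sum>i. ennreal \<bar>b i * E i\<bar>) \<partial>OmegaE) = ennreal (\<Sum>i. \<bar>b i\<bar>)"
proof -
  have "(\<integral>\<^sup>+E. ennreal \<bar>b i * E i\<bar> \<partial>OmegaE) = ennreal \<bar>b i\<bar>" for i
    using nn_integral_OmegaE_component[of "\<lambda>x. ennreal \<bar>x\<bar>" i]
    by (simp add: abs_mult ennreal_mult nn_integral_cmult nn_integral_Exp1_abs)
  then have "(\<integral>\<^sup>+E. (\<Sum>i. ennreal \<bar>b i * E i\<bar>) \<partial>OmegaE) = (\<Sum>i. ennreal \<bar>b i\<bar>)"
    by (subst nn_integral_suminf) auto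
  also have "\<dots> = ennreal (\<Sum>i. \<bar>b i\<bar>)"
    using assms by (intro suminf_ennreal2) auto
  finally show ?thesis .
qed

lemma AE_summable_OmegaE:
  assumes "summable (\<lambda>i. \<bar>b i\<bar>)"
  shows "AE E in OmegaE. summable (\<lambda>i. \<bar>b i * E i\<bar>)"
proof -
  have "AE E in OmegaE. (\<Sum>i. ennreal \<bar>b i * E i\<bar>) \<noteq> \<infinity>"
  proof (rule nn_integral_noteq_infinite)
    show "(\<lambda>E. \<Sum>i. ennreal \<bar>b i * E i\<bar>) \<in> borel_measurable OmegaE" by measurable
    show "(\<integral>\<^sup>+E. (\<Sum>i. ennreal \<bar>b i * E i\<bar>) \<partial>OmegaE) \<noteq> \<infinity>"
      unfolding nn_integral_suminf_abs_OmegaE[OF assms] by simp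
  qed
  then show ?thesis
  proof eventually_elim
    case (elim E)
    show ?case by (rule summable_suminf_not_top) (use elim in simp_all)
  qed
qed

text \<open>This bound converts the ell^1 convergence of the coefficients in (G1) and (G2) into L^1
  convergence of the random sums. The series may be subtracted termwise only where both converge,
  hence the passage through an almost sure statement.\<close>

lemma nn_integral_expsum_diff_le:
  assumes a: "summable (\<lambda>i. \<bar>a i\<bar>)" and b: "summable (\<lambda>i. \<bar>b i\<bar>)"
  shows "(\<integral>\<^sup>+E. ennreal \<bar>expsum a E - expsum b E\<bar> \<partial>OmegaE) \<le> ennreal (\<Sum>i. \<bar>a i - b i\<bar>)"
proof -
  have ab: "summable (\<lambda>i. \<bar>a i - b i\<bar>)"
    by (rule summable_comparison_test[OF _ summable_add[OF a b]]) (auto intro!: exI[of _ 0])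
  have "(\<integral>\<^sup>+E. ennreal \<bar>expsum a E - expsum b E\<bar> \<partial>OmegaE) \<le> (\<integral>\<^sup>+E. (\<Sum>i. ennreal \<bar>(a i - b i) * E i\<bar>) \<partial>OmegaE)"
  proof (rule nn_integral_mono_AE)
    show "AE E in OmegaE. ennreal \<bar>expsum a E - expsum b E\<bar> \<le> (\<Sum>i. ennreal \<bar>(a i - b i) * E i\<bar>)"
      using AE_summable_OmegaE[OF a] AE_summable_OmegaE[OF b] AE_summable_OmegaE[OF ab]
    proof eventually_elim
      case (elim E)
      have "expsum a E - expsum b E = (\<Sum>i. a i * E i - b i * E i)"
        unfolding expsum_def
        by (rule suminf_diff[OF summable_rabs_cancel[OF elim(1)] summable_rabs_cancel[OF elim(2)]])
      also have "\<dots> = (\<Sum>i. (a i - b i) * E i)"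
        by (simp add: algebra_simps)
      also have "\<bar>\<dots>\<bar> \<le> (\<Sum>i. \<bar>(a i - b i) * E i\<bar>)"
        using elim(3) by (intro summable_rabs)
      finally have "ennreal \<bar>expsum a E - expsum b E\<bar> \<le> ennreal (\<Sum>i. \<bar>(a i - b i) * E i\<bar>)"
        by (rule ennreal_leI)
      also have "\<dots> = (\<Sum>i. ennreal \<bar>(a i - b i) * E i\<bar>)"
        using elim(3) by (intro suminf_ennreal2[symmetric]) auto
      finally show ?case .
    qed
  qed
  also have "\<dots> = ennreal (\<Sum>i. \<bar>a i - b i\<bar>)"
    by (rule nn_integral_suminf_abs_OmegaE[OF ab])
  finally show ?thesis .
qed

text \<open>The law of a nontrivial \<open>expsum\<close> has no atoms, and a trivial one is \<open>0\<close>: integrating out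
  one coordinate with nonzero coefficient, at most one of its values is compatible with the others.\<close>
lemma AE_expsum_neq:
  assumes b: "summable (\<lambda>i. \<bar>b i\<bar>)" and c: "c \<noteq> 0"
  shows "AE E in OmegaE. expsum b E \<noteq> c"
proof (cases "\<forall>i. b i = 0")
  case True
  with c show ?thesis by (simp add: expsum_def)
next
  case False
  then obtain i where i: "b i \<noteq> 0" by auto
  let ?M = "\<lambda>_::nat. Exp1"
  let ?P = "PiM (UNIV - {i}) ?M"
  let ?upd = "\<lambda>(x, X). X(i := x) :: nat \<Rightarrow> real"
  interpret P: prob_space ?P by (intro prob_space_PiM prob_space_Exp1)
  have upd: "?upd \<in> measurable (Exp1 \<Otimes>\<^sub>M ?P) OmegaE"
    unfolding OmegaE_def split_beta'
    by (rule measurable_fun_upd[where J="UNIV - {i}"]) auto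
  have eq: "OmegaE = distr (Exp1 \<Otimes>\<^sub>M ?P) OmegaE ?upd"
    using distr_pair_PiM_eq_PiM[of "UNIV - {i}" ?M i] prob_space_Exp1
    by (simp add: OmegaE_def insert_absorb)
  \<comment> \<open>Absolute convergence is part of \<open>A\<close>, so that two of its points can
    be subtracted termwise; this discards only a null set.\<close>
  define A where "A = {E. (\<Sum>j. ennreal \<bar>b j * E j\<bar>) \<noteq> top \<and> expsum b E = c}"
  have "{E \<in> space OmegaE. (\<Sum>j. ennreal \<bar>b j * E j\<bar>) \<noteq> top \<and> expsum b E = c} \<in> sets OmegaE"
    by measurable
  then have A: "A \<in> sets OmegaE" by (simp add: A_def)
  have summable_A: "summable (\<lambda>j. b j * E j)" if "E \<in> A" for E
  proof (rule summable_rabs_cancel, rule summable_suminf_not_top)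
    show "(\<Sum>j. ennreal \<bar>b j * E j\<bar>) \<noteq> top" using that by (simp add: A_def)
  qed simp
  have sect: "emeasure Exp1 {x. X(i := x) \<in> A} = 0" for X
  proof -
    \<comment> \<open>Both points give the sum \<open>c\<close> and differ only in coordinate
      \<open>i\<close>, so \<open>b i * (x - y) = 0\<close>.\<close>
    have "x = y" if x: "X(i := x) \<in> A" and y: "X(i := y) \<in> A" for x y
    proof -
      have "0 = (\<Sum>j. b j * (X(i := x)) j) - (\<Sum>j. b j * (X(i := y)) j)"
        using x y by (simp add: A_def expsum_def)
      also have "\<dots> = (\<Sum>j. b j * (X(i := x)) j - b j * (X(i := y)) j)"
        by (rule suminf_diff[OF summable_A[OF x] summable_A[OF y]])
      also have "\<dots> = (\<Sum>j. if j = i then b i * (x - y) else 0)"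
        by (intro arg_cong[where f=suminf] ext) (simp add: algebra_simps)
      also have "\<dots> = b i * (x - y)"
        using sums_single[of i "\<lambda>j. b i * (x - y)"] by (simp add: sums_iff)
      finally show ?thesis using i by simp
    qed
    then have "{x. X(i := x) \<in> A} \<subseteq> {THE x. X(i := x) \<in> A}"
      using the_equality[of "\<lambda>x. X(i := x) \<in> A"] by blast
    then have "emeasure Exp1 {x. X(i := x) \<in> A} \<le> emeasure Exp1 {THE x. X(i := x) \<in> A}"
      by (intro emeasure_mono) auto
    then show ?thesis by (simp add: emeasure_Exp1_singleton)
  qed
  have "emeasure OmegaE A = emeasure (Exp1 \<Otimes>\<^sub>M ?P) (?upd -` A \<inter> space (Exp1 \<Otimes>\<^sub>M ?P))"
    using emeasure_distr[OF upd A] eq by simp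
  also have "\<dots> = (\<integral>\<^sup>+X. emeasure Exp1 ((\<lambda>x. (x, X)) -` (?upd -` A \<inter> space (Exp1 \<Otimes>\<^sub>M ?P))) \<partial>?P)"
  proof -
    interpret pair_sigma_finite Exp1 ?P ..
    show ?thesis by (intro emeasure_pair_measure_alt2 measurable_sets[OF upd A])
  qed
  also have "\<dots> = (\<integral>\<^sup>+X. 0 \<partial>?P)"
    using sect by (intro nn_integral_cong) (simp add: space_pair_measure vimage_def)
  finally have "emeasure OmegaE A = 0" by simp
  then have "AE E in OmegaE. E \<notin> A"
    using A by (intro AE_not_in) (auto simp: null_sets_def)
  then show ?thesis
    using AE_summable_OmegaE[OF b]
  proof eventually_elim
    case (elim E)
    then have "(\<Sum>j. ennreal \<bar>b j * E j\<bar>) = ennreal (\<Sum>j. \<bar>b j * E j\<bar>)"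
      by (intro suminf_ennreal2) auto
    with elim(1) show ?case by (simp add: A_def)
  qed
qed

text \<open>For every \<open>e > 0\<close> the increments of a bounded uniformly continuous function
  are at most \<open>e / 2 + K * |x - y|\<close>; taking expectations turns L^1 convergence directly
  into the claim.\<close>

lemma (in prob_space) expectation_tendsto_of_L1:
  fixes \<phi> :: "real \<Rightarrow> real"
  assumes unif: "uniformly_continuous_on UNIV \<phi>" and bound: "\<And>x. \<bar>\<phi> x\<bar> \<le> B"
    and X [measurable]: "\<And>n. X n \<in> borel_measurable M" and Y [measurable]: "Y \<in> borel_measurable M"
    and lim: "(\<lambda>n. \<integral>\<^sup>+\<omega>. ennreal \<bar>X n \<omega> - Y \<omega>\<bar> \<partial>M) \<longlonglongrightarrow> 0"
  shows "(\<lambda>n. expectation (\<lambda>\<omega>. \<phi> (X n \<omega>))) \<longlonglongrightarrow> expectation (\<lambda>\<omega>. \<phi> (Y \<omega>))"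
proof (rule LIMSEQ_I)
  fix e :: real assume e: "0 < e"
  have [measurable]: "\<phi> \<in> borel_measurable borel"
    using unif by (intro borel_measurable_continuous_onI uniformly_continuous_imp_continuous)
  have B: "0 \<le> B" using bound[of 0] by linarith
  obtain d where d: "0 < d" "\<And>x y. \<bar>x - y\<bar> < d \<Longrightarrow> \<bar>\<phi> x - \<phi> y\<bar> < e / 2"
    using unif e unfolding uniformly_continuous_on_def dist_real_def by (metis UNIV_I half_gt_zero)
  \<comment> \<open>With this constant \<open>K * |x - y|\<close> is at least \<open>2 * B\<close>
    once \<open>|x - y|\<close> reaches \<open>d\<close>, which covers the pairs that uniform
    continuity does not.\<close>
  define K where "K = 2 * B / d"
  have K: "0 \<le> K" unfolding K_def using B d by simp
  have le: "\<bar>\<phi> x - \<phi> y\<bar> \<le> e / 2 + K * \<bar>x - y\<bar>" for x y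
  proof (cases "\<bar>x - y\<bar> < d")
    case True
    then show ?thesis using d(2)[OF True] mult_nonneg_nonneg[OF K abs_ge_zero[of "x - y"]] by linarith
  next
    case False
    then have "2 * B \<le> K * \<bar>x - y\<bar>"
      using d(1) B mult_left_mono[of d "\<bar>x - y\<bar>" K] K by (simp add: K_def)
    then show ?thesis using bound[of x] bound[of y] e by linarith
  qed
  have int: "integrable M (\<lambda>\<omega>. \<phi> (X n \<omega>))" "integrable M (\<lambda>\<omega>. \<phi> (Y \<omega>))" for n
    by (rule integrable_const_bound[of _ B]; use bound in simp)+
  have main: "ennreal \<bar>expectation (\<lambda>\<omega>. \<phi> (X n \<omega>)) - expectation (\<lambda>\<omega>. \<phi> (Y \<omega>))\<bar>
      \<le> ennreal (e / 2) + ennreal K * (\<integral>\<^sup>+\<omega>. ennreal \<bar>X n \<omega> - Y \<omega>\<bar> \<partial>M)" for n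
  proof -
    have "ennreal \<bar>expectation (\<lambda>\<omega>. \<phi> (X n \<omega>)) - expectation (\<lambda>\<omega>. \<phi> (Y \<omega>))\<bar>
       = ennreal (norm (expectation (\<lambda>\<omega>. \<phi> (X n \<omega>) - \<phi> (Y \<omega>))))"
      using int by simp
    also have "\<dots> \<le> (\<integral>\<^sup>+\<omega>. ennreal (norm (\<phi> (X n \<omega>) - \<phi> (Y \<omega>))) \<partial>M)"
      using int by (intro integral_norm_bound_ennreal) auto
    also have "\<dots> \<le> (\<integral>\<^sup>+\<omega>. ennreal (e / 2) + ennreal K * ennreal \<bar>X n \<omega> - Y \<omega>\<bar> \<partial>M)"
      using le e K
      by (intro nn_integral_mono) (auto simp: ennreal_mult[symmetric] ennreal_plus[symmetric] simp del: ennreal_plus intro!: ennreal_leI)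
    also have "\<dots> = ennreal (e / 2) + ennreal K * (\<integral>\<^sup>+\<omega>. ennreal \<bar>X n \<omega> - Y \<omega>\<bar> \<partial>M)"
      by (simp add: nn_integral_add nn_integral_cmult emeasure_space_1)
    finally show ?thesis .
  qed
  have "(\<lambda>n. ennreal K * (\<integral>\<^sup>+\<omega>. ennreal \<bar>X n \<omega> - Y \<omega>\<bar> \<partial>M)) \<longlonglongrightarrow> ennreal K * 0"
    using lim by (intro ennreal_tendsto_cmult) auto
  then have "\<forall>\<^sub>F n in sequentially. ennreal K * (\<integral>\<^sup>+\<omega>. ennreal \<bar>X n \<omega> - Y \<omega>\<bar> \<partial>M) < ennreal (e / 2)"
    using e by (intro order_tendstoD(2)[of _ "ennreal K * 0"]) auto
  then obtain N where N: "\<And>n. n \<ge> N \<Longrightarrow> ennreal K * (\<integral>\<^sup>+\<omega>. ennreal \<bar>X n \<omega> - Y \<omega>\<bar> \<partial>M) < ennreal (e / 2)"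
    by (auto simp: eventually_sequentially)
  have "\<bar>expectation (\<lambda>\<omega>. \<phi> (X n \<omega>)) - expectation (\<lambda>\<omega>. \<phi> (Y \<omega>))\<bar> < e" if "n \<ge> N" for n
  proof -
    have "ennreal (e / 2) + ennreal K * (\<integral>\<^sup>+\<omega>. ennreal \<bar>X n \<omega> - Y \<omega>\<bar> \<partial>M) < ennreal (e / 2) + ennreal (e / 2)"
      using N[OF that] by (subst ennreal_add_left_cancel_less) auto
    also have "\<dots> = ennreal e" using e by (simp add: ennreal_plus[symmetric] del: ennreal_plus)
    finally have "ennreal \<bar>expectation (\<lambda>\<omega>. \<phi> (X n \<omega>)) - expectation (\<lambda>\<omega>. \<phi> (Y \<omega>))\<bar> < ennreal e"
      using main[of n] by (rule le_less_trans[rotated])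
    then show ?thesis by (simp add: ennreal_less_iff)
  qed
  then show "\<exists>no. \<forall>n\<ge>no. norm (expectation (\<lambda>\<omega>. \<phi> (X n \<omega>)) - expectation (\<lambda>\<omega>. \<phi> (Y \<omega>))) < e"
    by auto
qed

text \<open>Moving the threshold \<open>c n\<close> into the random variable allows distribution
  functions to be compared at the fixed point 0.\<close>

lemma nn_integral_expsum_shift_tendsto:
  assumes a: "\<And>n. summable (\<lambda>i. \<bar>a n i\<bar>)" and b: "summable (\<lambda>i. \<bar>b i\<bar>)"
    and lim: "(\<lambda>n. \<Sum>i. \<bar>a n i - b i\<bar>) \<longlonglongrightarrow> 0" and c: "c \<longlonglongrightarrow> c'"
  shows "(\<lambda>n. \<integral>\<^sup>+E. ennreal \<bar>(expsum (a n) E - c n) - (expsum b E - c')\<bar> \<partial>OmegaE) \<longlonglongrightarrow> 0"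
proof (rule tendsto_sandwich[OF _ _ tendsto_const])
  show "\<forall>\<^sub>F n in sequentially. 0 \<le> (\<integral>\<^sup>+E. ennreal \<bar>(expsum (a n) E - c n) - (expsum b E - c')\<bar> \<partial>OmegaE)"
    by simp
  show "\<forall>\<^sub>F n in sequentially. (\<integral>\<^sup>+E. ennreal \<bar>(expsum (a n) E - c n) - (expsum b E - c')\<bar> \<partial>OmegaE)
      \<le> ennreal (\<Sum>i. \<bar>a n i - b i\<bar>) + ennreal \<bar>c n - c'\<bar>"
  proof (intro always_eventually allI)
    fix n
    have "(\<integral>\<^sup>+E. ennreal \<bar>(expsum (a n) E - c n) - (expsum b E - c')\<bar> \<partial>OmegaE)
      \<le> (\<integral>\<^sup>+E. ennreal \<bar>expsum (a n) E - expsum b E\<bar> + ennreal \<bar>c n - c'\<bar> \<partial>OmegaE)"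
      by (intro nn_integral_mono) (auto simp: ennreal_plus[symmetric] simp del: ennreal_plus intro!: ennreal_leI)
    also have "\<dots> = (\<integral>\<^sup>+E. ennreal \<bar>expsum (a n) E - expsum b E\<bar> \<partial>OmegaE) + ennreal \<bar>c n - c'\<bar>"
      by (simp add: nn_integral_add)
    also have "\<dots> \<le> ennreal (\<Sum>i. \<bar>a n i - b i\<bar>) + ennreal \<bar>c n - c'\<bar>"
      by (intro add_right_mono nn_integral_expsum_diff_le a b)
    finally show "(\<integral>\<^sup>+E. ennreal \<bar>(expsum (a n) E - c n) - (expsum b E - c')\<bar> \<partial>OmegaE)
      \<le> ennreal (\<Sum>i. \<bar>a n i - b i\<bar>) + ennreal \<bar>c n - c'\<bar>" .
  qed
  have "(\<lambda>n. \<bar>c n - c'\<bar>) \<longlonglongrightarrow> 0"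
    using c by (simp add: LIM_zero_iff tendsto_rabs_zero)
  then have "(\<lambda>n. ennreal (\<Sum>i. \<bar>a n i - b i\<bar>) + ennreal \<bar>c n - c'\<bar>) \<longlonglongrightarrow> ennreal 0 + ennreal 0"
    using lim by (intro tendsto_add tendsto_ennrealI)
  then show "(\<lambda>n. ennreal (\<Sum>i. \<bar>a n i - b i\<bar>) + ennreal \<bar>c n - c'\<bar>) \<longlonglongrightarrow> 0" by simp
qed

lemma expectation_expsum_tendsto:
  fixes \<phi> :: "real \<Rightarrow> real"
  assumes "\<And>n. summable (\<lambda>i. \<bar>a n i\<bar>)" "summable (\<lambda>i. \<bar>b i\<bar>)"
    "(\<lambda>n. \<Sum>i. \<bar>a n i - b i\<bar>) \<longlonglongrightarrow> 0"
    and "uniformly_continuous_on UNIV \<phi>" "\<And>x. \<bar>\<phi> x\<bar> \<le> B"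
  shows "(\<lambda>n. OmegaE.expectation (\<lambda>E. \<phi> (expsum (a n) E))) \<longlonglongrightarrow> OmegaE.expectation (\<lambda>E. \<phi> (expsum b E))"
  using nn_integral_expsum_shift_tendsto[OF assms(1-3), of "\<lambda>_. 0" 0] assms(4,5)
  by (intro OmegaE.expectation_tendsto_of_L1[of \<phi> B]) simp_all

text \<open>Both probabilities are distribution functions at 0 of the shifted sums. The shifted laws
  converge weakly, as tested on the functions \<open>cts_step\<close>, and 0 is a continuity point
  of the limit: \<open>c'\<close> is nonzero, so it is no atom even when all coefficients
  vanish.\<close>

lemma prob_expsum_le_tendsto:
  assumes a: "\<And>n. summable (\<lambda>i. \<bar>a n i\<bar>)" and b: "summable (\<lambda>i. \<bar>b i\<bar>)"
    and lim: "(\<lambda>n. \<Sum>i. \<bar>a n i - b i\<bar>) \<longlonglongrightarrow> 0" and c: "c \<longlonglongrightarrow> c'" "c' \<noteq> 0"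
  shows "(\<lambda>n. OmegaE.prob {E. expsum (a n) E \<le> c n}) \<longlonglongrightarrow> OmegaE.prob {E. expsum b E \<le> c'}"
proof -
  define \<mu> where "\<mu> n = distr OmegaE borel (\<lambda>E. expsum (a n) E - c n)" for n
  define \<nu> where "\<nu> = distr OmegaE borel (\<lambda>E. expsum b E - c')"
  have dist: "real_distribution (\<mu> n)" "real_distribution \<nu>" for n
    unfolding \<mu>_def \<nu>_def by (intro OmegaE.real_distribution_distr; measurable)+
  have "weak_conv_m \<mu> \<nu>"
  proof (rule integral_cts_step_conv_imp_weak_conv[OF dist])
    fix x y :: real assume xy: "x < y"
    have [measurable]: "cts_step x y \<in> borel_measurable borel"
      using cts_step_uniformly_continuous[OF xy]
      by (intro borel_measurable_continuous_onI uniformly_continuous_imp_continuous)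
    have "(\<lambda>n. OmegaE.expectation (\<lambda>E. cts_step x y (expsum (a n) E - c n))) \<longlonglongrightarrow>
        OmegaE.expectation (\<lambda>E. cts_step x y (expsum b E - c'))"
      using xy
      by (intro OmegaE.expectation_tendsto_of_L1[where B=1] cts_step_uniformly_continuous
           nn_integral_expsum_shift_tendsto a b lim c) (auto simp: cts_step_def)
    then show "(\<lambda>n. integral\<^sup>L (\<mu> n) (cts_step x y)) \<longlonglongrightarrow> integral\<^sup>L \<nu> (cts_step x y)"
      unfolding \<mu>_def \<nu>_def by (subst (1 2) integral_distr) auto
  qed
  moreover have "isCont (cdf \<nu>) 0"
  proof -
    interpret \<nu>: real_distribution \<nu> by (rule dist)
    have "measure \<nu> {0} = OmegaE.prob {E. expsum b E = c'}"
      unfolding \<nu>_def by (subst measure_distr) (auto simp: vimage_def)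
    also have "\<dots> = 0"
    proof (subst OmegaE.prob_eq_0)
      have "{E \<in> space OmegaE. expsum b E = c'} \<in> sets OmegaE" by measurable
      then show "{E. expsum b E = c'} \<in> OmegaE.events" by simp
    qed (use AE_expsum_neq[OF b c(2)] in simp)
    finally show ?thesis by (simp add: \<nu>.isCont_cdf)
  qed
  ultimately have "(\<lambda>n. cdf (\<mu> n) 0) \<longlonglongrightarrow> cdf \<nu> 0"
    by (simp add: weak_conv_m_def weak_conv_def)
  moreover have "cdf (\<mu> n) 0 = OmegaE.prob {E. expsum (a n) E \<le> c n}" for n
    unfolding \<mu>_def cdf_def by (subst measure_distr) (auto simp: vimage_def)
  moreover have "cdf \<nu> 0 = OmegaE.prob {E. expsum b E \<le> c'}"
    unfolding \<nu>_def cdf_def by (subst measure_distr) (auto simp: vimage_def)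
  ultimately show ?thesis by simp
qed

section \<open>Paths\<close>

text \<open>The squared positive part is differentiable across its kink, since at 0 the difference
  quotient is at most \<open>|h|\<close> in absolute value. It supplies the primitive of a rate
  proportional to a positive part.\<close>

lemma has_real_derivative_max_0_power2:
  "((\<lambda>z. (max z 0)\<^sup>2) has_real_derivative 2 * max z 0) (at (z::real))"
proof -
  consider "z < 0" | "z = 0" | "0 < z" by linarith
  then show ?thesis
  proof cases
    case 1
    have "((\<lambda>z. 0) has_real_derivative 2 * max z 0) (at z)"
      using 1 by (simp add: max_def)
    then show ?thesis
      by (rule has_field_derivative_transform_within_open[of _ _ _ "{..<0}"]) (use 1 in \<open>auto simp: max_def\<close>)
  next
    case 2
    have "((\<lambda>h. ((max (0 + h) 0)\<^sup>2 - (max 0 0)\<^sup>2) / h) \<longlongrightarrow> 0) (at (0::real))"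
    proof (rule Lim_null_comparison)
      show "\<forall>\<^sub>F h in at 0. norm (((max (0 + h) 0)\<^sup>2 - (max 0 0)\<^sup>2) / h) \<le> \<bar>h::real\<bar>"
        by (rule always_eventually) (auto simp: max_def power2_eq_square)
      show "((\<lambda>h. \<bar>h\<bar>) \<longlongrightarrow> 0) (at (0::real))"
        by (rule tendsto_rabs_zero) (rule tendsto_ident_at)
    qed
    then show ?thesis using 2 by (simp add: DERIV_def)
  next
    case 3
    have "((\<lambda>z. z\<^sup>2) has_real_derivative 2 * max z 0) (at z)"
      using 3 by (auto intro!: derivative_eq_intros)
    then show ?thesis
      by (rule has_field_derivative_transform_within_open[of _ _ _ "{0<..}"]) (use 3 in \<open>auto simp: max_def\<close>)
  qed
qed

lemma integral_max_affine:
  fixes c p q s :: real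
  assumes "q \<noteq> 0" "0 \<le> s"
  shows "integral {0..s} (\<lambda>r. c * max (p + q * r) 0) = c / (2 * q) * ((max (p + q * s) 0)\<^sup>2 - (max p 0)\<^sup>2)"
proof -
  have "((\<lambda>r. c * max (p + q * r) 0) has_integral
      c / (2 * q) * (max (p + q * s) 0)\<^sup>2 - c / (2 * q) * (max (p + q * 0) 0)\<^sup>2) {0..s}"
  proof (rule fundamental_theorem_of_calculus)
    fix r assume "r \<in> {0..s}"
    have "((\<lambda>r. p + q * r) has_real_derivative q) (at r)"
      by (auto intro!: derivative_eq_intros)
    from DERIV_chain2[OF has_real_derivative_max_0_power2 this]
    have "((\<lambda>r. c / (2 * q) * (max (p + q * r) 0)\<^sup>2) has_real_derivative c / (2 * q) * (2 * max (p + q * r) 0 * q)) (at r)"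
      by (rule DERIV_cmult)
    moreover have "c / (2 * q) * (2 * max (p + q * r) 0 * q) = c * max (p + q * r) 0"
      using assms by simp
    ultimately have "((\<lambda>r. c / (2 * q) * (max (p + q * r) 0)\<^sup>2) has_real_derivative c * max (p + q * r) 0) (at r)"
      by (simp only:)
    then have "((\<lambda>r. c / (2 * q) * (max (p + q * r) 0)\<^sup>2) has_vector_derivative c * max (p + q * r) 0) (at r)"
      by (simp only: has_real_derivative_iff_has_vector_derivative)
    then show "((\<lambda>r. c / (2 * q) * (max (p + q * r) 0)\<^sup>2) has_vector_derivative c * max (p + q * r) 0) (at r within {0..s})"
      by (rule has_vector_derivative_at_within)
  qed (fact assms)
  from integral_unique[OF this] show ?thesis
    by (simp only: right_diff_distrib mult_zero_right add_0_right)
qed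

lemma hit_time_eq:
  assumes "0 < s" "integral {0..s} (\<lambda>r. a x j (y + v x * r)) = e"
    and "\<And>r. 0 < r \<Longrightarrow> r < s \<Longrightarrow> integral {0..r} (\<lambda>r. a x j (y + v x * r)) < e"
  shows "hit_time v a x y j e = ereal s"
  unfolding hit_time_def
proof (rule antisym)
  show "Inf (ereal ` {s. 0 < s \<and> e \<le> integral {0..s} (\<lambda>r. a x j (y + v x * r))}) \<le> ereal s"
    using assms by (intro Inf_lower imageI) simp
  show "ereal s \<le> Inf (ereal ` {s. 0 < s \<and> e \<le> integral {0..s} (\<lambda>r. a x j (y + v x * r))})"
  proof (rule Inf_greatest)
    fix t assume "t \<in> ereal ` {s. 0 < s \<and> e \<le> integral {0..s} (\<lambda>r. a x j (y + v x * r))}"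
    then obtain r where "t = ereal r" "0 < r" "e \<le> integral {0..r} (\<lambda>r. a x j (y + v x * r))" by auto
    with assms(3)[of r] show "ereal s \<le> t" by (cases "r < s") auto
  qed
qed

lemma hit_time_eq_infinity:
  assumes "\<And>r. 0 < r \<Longrightarrow> integral {0..r} (\<lambda>r. a x j (y + v x * r)) < e"
  shows "hit_time v a x y j e = \<infinity>"
proof -
  have *: "{s. 0 < s \<and> e \<le> integral {0..s} (\<lambda>r. a x j (y + v x * r))} = {}"
    using assms by (auto simp: not_le)
  show ?thesis unfolding hit_time_def * by (simp add: top_ereal_def)
qed

text \<open>The cumulative intensity is continuous and starts at 0, so it stays below a positive
  threshold on an initial interval. This keeps the jump after the exit strictly later than the
  exit.\<close>

lemma hit_time_pos:
  assumes cont: "continuous_on UNIV (a x j)" and e: "0 < e"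
  shows "0 < hit_time v a x y j e"
proof -
  define F where "F s = integral {0..s} (\<lambda>r. a x j (y + v x * r))" for s
  have "continuous_on {0..1} (\<lambda>r. y + v x * r)"
    by (intro continuous_intros)
  from continuous_on_compose2[OF cont this]
  have "(\<lambda>r. a x j (y + v x * r)) integrable_on {0..1}"
    by (intro integrable_continuous_interval) auto
  then have "continuous_on {0..1} F"
    unfolding F_def by (rule indefinite_integral_continuous_1)
  then have "(F \<longlongrightarrow> F 0) (at 0 within {0..1})"
    by (simp add: continuous_on_def)
  moreover have "F 0 = 0" by (simp add: F_def)
  ultimately have "\<forall>\<^sub>F s in at 0 within {0..1}. F s < e"
    using e by (intro order_tendstoD(2)) simp_all
  then obtain d where d: "0 < d" "\<And>s. s \<in> {0..1} \<Longrightarrow> s \<noteq> 0 \<Longrightarrow> dist s 0 < d \<Longrightarrow> F s < e"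
    unfolding eventually_at by blast
  \<comment> \<open>The minimum stays within the radius \<open>d\<close> and within the unit
    interval on which continuity of \<open>F\<close> was obtained.\<close>
  have "ereal (min (d / 2) 1) \<le> hit_time v a x y j e"
    unfolding hit_time_def
  proof (rule Inf_greatest)
    fix t assume "t \<in> ereal ` {s. 0 < s \<and> e \<le> integral {0..s} (\<lambda>r. a x j (y + v x * r))}"
    then obtain s where s: "t = ereal s" "0 < s" "e \<le> F s" by (auto simp: F_def)
    have "min (d / 2) 1 \<le> s"
    proof (rule leI, rule notI)
      assume "s < min (d / 2) 1"
      then have "s < d / 2" "s < 1" by simp_all
      then have "F s < e" using d(1) s(2) by (intro d(2)) auto
      with s(3) show False by simp
    qed
    then show "ereal (min (d / 2) 1) \<le> t" by (simp only: s(1) ereal_less_eq(3))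
  qed
  moreover have "0 < min (d / 2) 1" using d by simp
  then have "0 < ereal (min (d / 2) 1)" by (simp only: zero_ereal_def less_ereal.simps(1))
  ultimately show ?thesis by (rule less_le_trans[rotated])
qed

text \<open>Strict inequality makes the minimiser unique, so the tie-breaking \<open>LEAST\<close>
  returns \<open>j\<close> itself.\<close>

lemma jump_step_eq:
  assumes j: "j \<le> n" "hit_time v a x y j (e j) = ereal s"
    and other: "\<And>i. i \<le> n \<Longrightarrow> i \<noteq> j \<Longrightarrow> ereal s < hit_time v a x y i (e i)"
  shows "jump_step n v a (x, y, T) e = (j, y + v x * s, T + ereal s)"
proof -
  have m: "Min ((\<lambda>j. hit_time v a x y j (e j)) ` {..n}) = ereal s"
  proof (rule Min_eqI)
    show "ereal s \<in> (\<lambda>j. hit_time v a x y j (e j)) ` {..n}"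
      using j by (intro image_eqI[of _ _ j]) auto
    fix t assume "t \<in> (\<lambda>j. hit_time v a x y j (e j)) ` {..n}"
    then obtain i where "i \<le> n" "t = hit_time v a x y i (e i)" by auto
    then show "ereal s \<le> t" using other[of i] j by (cases "i = j") auto
  qed simp
  have "(LEAST i. i \<le> n \<and> hit_time v a x y i (e i) = ereal s) = j"
  proof (rule Least_equality)
    fix i assume i: "i \<le> n \<and> hit_time v a x y i (e i) = ereal s"
    then have "i = j" using other[of i] by (cases "i = j") auto
    then show "j \<le> i" by simp
  qed (use j in simp)
  then show ?thesis
    unfolding jump_step_def Let_def prod.case m by simp
qed

text \<open>Records a finite explicit stretch of a path. Jump \<open>K + 1\<close> is only required
  to come after \<open>t K\<close>, possibly at infinity, which suffices to read the process at time
  \<open>t K\<close>.\<close>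

locale chain_times =
  fixes n :: nat and v :: "nat \<Rightarrow> real" and a :: "nat \<Rightarrow> nat \<Rightarrow> real \<Rightarrow> real" and x0 :: nat and y0 :: real
    and \<omega> :: "nat \<Rightarrow> nat \<Rightarrow> real" and K :: nat and X :: "nat \<Rightarrow> nat" and Y t :: "nat \<Rightarrow> real"
  assumes chain: "\<And>k. k \<le> K \<Longrightarrow> chain n v a x0 y0 \<omega> k = (X k, Y k, ereal (t k))"
    and t_mono: "\<And>k. k < K \<Longrightarrow> t k < t (Suc k)"
    and t_last: "ereal (t K) < snd (snd (chain n v a x0 y0 \<omega> (Suc K)))"
begin

abbreviation "T k \<equiv> snd (snd (chain n v a x0 y0 \<omega> k))"

lemma t_0: "t 0 = 0"
  using chain[of 0] by (simp add: zero_ereal_def)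

lemma t_le: "i \<le> j \<Longrightarrow> j \<le> K \<Longrightarrow> t i \<le> t j"
proof (induction j)
  case (Suc j)
  then show ?case using t_mono[of j] by (cases "i = Suc j") auto
qed simp

lemma jump_index_eq:
  assumes "k \<le> K" "t k \<le> r" "ereal r < T (Suc k)"
  shows "jump_index n v a x0 y0 \<omega> r = k"
  unfolding jump_index_def
proof (rule Least_equality)
  fix i assume i: "ereal r < T (Suc i)"
  show "k \<le> i"
  proof (rule ccontr)
    assume "\<not> k \<le> i"
    then have "Suc i \<le> k" by simp
    then have "t (Suc i) \<le> t k" "T (Suc i) = ereal (t (Suc i))"
      using t_le[of "Suc i" k] chain[of "Suc i"] assms(1) by auto
    with i assms(2) show False by simp
  qed
qed (fact assms)

lemma process_eq:
  assumes "k \<le> K" "t k \<le> r" "ereal r < T (Suc k)"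
  shows "Xproc n v a x0 y0 \<omega> r = X k" "Lproc n v a x0 y0 \<omega> r = Y k + v (X k) * (r - t k)"
  unfolding Xproc_def Lproc_def jump_index_eq[OF assms] chain[OF assms(1)] by simp_all

lemma process_eq_before:
  assumes "k < K" "t k \<le> r" "r < t (Suc k)"
  shows "Xproc n v a x0 y0 \<omega> r = X k" "Lproc n v a x0 y0 \<omega> r = Y k + v (X k) * (r - t k)"
  using process_eq[of k r] assms chain[of "Suc k"] by auto

lemma ex_interval:
  assumes "m \<le> K" "0 \<le> r" "r < t m"
  obtains k where "k < m" "t k \<le> r" "r < t (Suc k)"
proof -
  define k where "k = (LEAST k. r < t k)"
  have k: "r < t k" "k \<le> m"
    unfolding k_def using assms(3) by (auto intro: LeastI Least_le)
  have "k \<noteq> 0" using k t_0 assms(2) by (intro notI) simp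
  then obtain i where i: "k = Suc i" by (cases k) auto
  then have "\<not> r < t i" unfolding k_def by (intro not_less_Least) simp
  then show ?thesis using k i by (intro that[of i]) auto
qed

text \<open>Piece \<open>K\<close> of the path includes its left endpoint, so the infimum is
  attained at \<open>t K\<close>.\<close>

lemma exit_time_eq:
  assumes "\<And>k. k < K \<Longrightarrow> X k \<in> B" "X K \<notin> B"
    and \<rho>: "0 \<le> rev_time n v a x0 y0 \<omega>" "rev_time n v a x0 y0 \<omega> \<le> t K"
  shows "exit_time n v a x0 y0 B \<omega> = t K"
  unfolding exit_time_def
proof (rule cInf_eq_minimum)
  have "Xproc n v a x0 y0 \<omega> (t K) = X K"
    using process_eq[of K "t K"] t_last by simp
  then show "t K \<in> {t. rev_time n v a x0 y0 \<omega> \<le> t \<and> Xproc n v a x0 y0 \<omega> t \<notin> B}"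
    using assms by simp
  fix r assume "r \<in> {t. rev_time n v a x0 y0 \<omega> \<le> t \<and> Xproc n v a x0 y0 \<omega> t \<notin> B}"
  then have r: "0 \<le> r" "Xproc n v a x0 y0 \<omega> r \<notin> B" using \<rho> by auto
  show "t K \<le> r"
  proof (rule leI, rule notI)
    assume "r < t K"
    with r obtain k where k: "k < K" "t k \<le> r" "r < t (Suc k)" using ex_interval[of K r] by auto
    from process_eq_before(1)[OF k] assms(1)[OF k(1)] r show False by simp
  qed
qed

text \<open>With positive slopes the memory increases along each piece; it is negative at the jumps
  up to \<open>m\<close> and positive at jump \<open>m + 1\<close>, so its first zero lies on piece
  \<open>m\<close>. Locating the piece is enough to determine the state at reversal.\<close>

lemma rev_time_eq:
  assumes m: "m < K" and v: "\<And>k. k \<le> m \<Longrightarrow> 0 < v (X k)"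
    and Y: "\<And>k. k \<le> m \<Longrightarrow> Y k < 0" "0 < Y (Suc m)"
    and step: "\<And>k. k \<le> m \<Longrightarrow> Y (Suc k) = Y k + v (X k) * (t (Suc k) - t k)"
  shows "t m \<le> rev_time n v a x0 y0 \<omega>" "rev_time n v a x0 y0 \<omega> < t (Suc m)"
proof -
  \<comment> \<open>The zero of the affine piece that starts from \<open>Y m\<close> with slope
    \<open>v (X m)\<close>.\<close>
  define \<rho> where "\<rho> = t m - Y m / v (X m)"
  have vm: "0 < v (X m)" and Ym: "Y m < 0" using v Y by auto
  have "Y m / v (X m) < 0" using vm Ym by (rule divide_neg_pos[rotated])
  then have \<rho>: "t m \<le> \<rho>" by (simp add: \<rho>_def)
  have "- Y m < v (X m) * (t (Suc m) - t m)" using step[of m] Y(2) by simp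
  then have "- Y m / v (X m) < t (Suc m) - t m" using vm by (subst pos_divide_less_eq) (simp_all add: mult.commute)
  then have \<rho>': "\<rho> < t (Suc m)" by (simp add: \<rho>_def)
  have "rev_time n v a x0 y0 \<omega> = \<rho>"
    unfolding rev_time_def
  proof (rule cInf_eq_minimum)
    have "Lproc n v a x0 y0 \<omega> \<rho> = 0"
      unfolding process_eq_before(2)[OF m \<rho> \<rho>'] using vm by (simp add: \<rho>_def)
    moreover have "0 \<le> \<rho>" using t_le[of 0 m] t_0 m \<rho> by simp
    ultimately show "\<rho> \<in> {t. 0 \<le> t \<and> 0 \<le> Lproc n v a x0 y0 \<omega> t}" by simp
    fix r assume "r \<in> {t. 0 \<le> t \<and> 0 \<le> Lproc n v a x0 y0 \<omega> t}"
    then have r: "0 \<le> r" "0 \<le> Lproc n v a x0 y0 \<omega> r" by auto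
    show "\<rho> \<le> r"
    proof (rule leI, rule notI)
      assume lt: "r < \<rho>"
      then obtain k where k: "k < Suc m" "t k \<le> r" "r < t (Suc k)"
        using ex_interval[of "Suc m" r] r m \<rho>' by auto
      have L: "Lproc n v a x0 y0 \<omega> r = Y k + v (X k) * (r - t k)"
        using k m by (intro process_eq_before) auto
      have vk: "0 < v (X k)" using v k by simp
      have "Y k + v (X k) * (r - t k) < 0"
      proof (cases "k = m")
        case True
        have "v (X m) * (r - t m) < v (X m) * (\<rho> - t m)" using lt vm by simp
        also have "\<dots> = - Y m" using vm by (simp add: \<rho>_def)
        finally show ?thesis using True by simp
      next
        case False
        have "v (X k) * (r - t k) < v (X k) * (t (Suc k) - t k)" using k vk by simp
        then show ?thesis using step[of k] Y(1)[of "Suc k"] k False by simp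
      qed
      with L r show False by simp
    qed
  qed
  with \<rho> \<rho>' show "t m \<le> rev_time n v a x0 y0 \<omega>" "rev_time n v a x0 y0 \<omega> < t (Suc m)" by auto
qed

end

section \<open>The explicit path through the lower boundary layer\<close>

lemma continuous_on_rateN: "continuous_on UNIV (rateN n N0 N1 v x j)"
proof -
  have *: "rateN n N0 N1 v x j = (\<lambda>l. (if j = Suc x \<and> x < n then cN n N0 N1 v x else 0) * max l 0 +
      (if x = Suc j \<and> j < n then cN n N0 N1 v j else 0) * max (- l) 0)"
    unfolding rateN_def by (auto simp: fun_eq_iff)
  show ?thesis
    unfolding * by (intro continuous_intros)
qed

text \<open>Until the exit the process stays in \<open>{0..N0}\<close>, where the memory always
  increases; these assumptions govern the path up to that time.\<close>

locale lower_layer =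
  fixes n N0 N1 :: nat and v :: "nat \<Rightarrow> real"
  assumes N0_less: "N0 < n" and v_pos: "\<And>j. j \<le> N0 \<Longrightarrow> 0 < v j"
begin

abbreviation "a \<equiv> rateN n N0 N1 v"
abbreviation "c \<equiv> cN n N0 N1 v"
abbreviation "\<mu> \<equiv> muN n N0 N1 v"
abbreviation "lam \<equiv> lamN n N0 N1 v"

lemma c_pos: "i \<le> N0 \<Longrightarrow> 0 < c i"
proof -
  assume "i \<le> N0"
  moreover from this have "0 < sum v {..i}" using v_pos by (intro sum_pos) auto
  ultimately show ?thesis by (simp add: cN_def)
qed

lemma c_nonneg: "0 \<le> c i"
proof (cases "i \<le> N0")
  case True
  then show ?thesis using c_pos[of i] by simp
qed (auto simp: cN_def intro!: sum_nonneg)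

lemma rateN_nonneg: "0 \<le> a i j l"
  unfolding rateN_def using c_nonneg by (auto intro!: mult_nonneg_nonneg)

lemma \<mu>_pos: "i < N0 \<Longrightarrow> 0 < \<mu> i"
  using v_pos[of "Suc i"] c_pos[of i] by (simp add: muN_def)

lemma lam_pos: "i \<le> N0 \<Longrightarrow> 0 < lam i"
  using v_pos[of i] c_pos[of i] by (simp add: lamN_def)

text \<open>Nothing accumulates while the memory is negative; afterwards the intensity grows with
  the squared memory, and \<open>c x / v x\<close> is the reciprocal of
  \<open>lam x\<close>.\<close>

lemma integral_rate_up:
  assumes "x \<le> N0" "0 \<le> s"
  shows "integral {0..s} (\<lambda>r. a x (Suc x) (y + v x * r)) =
    ((max (y + v x * s) 0)\<^sup>2 - (max y 0)\<^sup>2) / (2 * lam x)"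
proof -
  have "integral {0..s} (\<lambda>r. a x (Suc x) (y + v x * r)) = integral {0..s} (\<lambda>r. c x * max (y + v x * r) 0)"
    using assms N0_less by (simp add: rateN_def)
  also have "\<dots> = c x / (2 * v x) * ((max (y + v x * s) 0)\<^sup>2 - (max y 0)\<^sup>2)"
    using assms v_pos[of x] by (intro integral_max_affine) auto
  finally show ?thesis
    using assms by (simp add: lamN_def)
qed

text \<open>This rate sees the negative part of the memory, so the affine argument is reflected and
  has slope \<open>- v (Suc i)\<close>. The edge between \<open>i\<close> and \<open>i + 1\<close>
  carries \<open>c i\<close>, and \<open>c i / v (Suc i)\<close> is the reciprocal of
  \<open>\<mu> i\<close>.\<close>

lemma integral_rate_down:
  assumes "Suc i \<le> N0" "0 \<le> s"
  shows "integral {0..s} (\<lambda>r. a (Suc i) i (y + v (Suc i) * r)) =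
    ((max (- y) 0)\<^sup>2 - (max (- (y + v (Suc i) * s)) 0)\<^sup>2) / (2 * \<mu> i)"
proof -
  have "integral {0..s} (\<lambda>r. a (Suc i) i (y + v (Suc i) * r)) = integral {0..s} (\<lambda>r. c i * max (- y + (- v (Suc i)) * r) 0)"
    using assms N0_less by (simp add: rateN_def)
  also have "\<dots> = c i / (2 * (- v (Suc i))) * ((max (- y + (- v (Suc i)) * s) 0)\<^sup>2 - (max (- y) 0)\<^sup>2)"
    using assms v_pos[of "Suc i"] by (intro integral_max_affine) auto
  also have "\<dots> = ((max (- y) 0)\<^sup>2 - (max (- (y + v (Suc i) * s)) 0)\<^sup>2) / (2 * \<mu> i)"
    using assms v_pos[of "Suc i"] c_pos[of i] by (simp add: muN_def field_simps)
  finally show ?thesis .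
qed

text \<open>The time \<open>s\<close> is when the memory reaches the level at which the intensity
  equals \<open>e\<close>. For negative \<open>y\<close> it falls after the zero of the memory at
  \<open>- y / v x\<close>, which is what lets a pending descent win.\<close>

lemma hit_time_up:
  fixes y e :: real
  assumes x: "x \<le> N0" and e: "0 < e"
  defines "s \<equiv> (sqrt ((max y 0)\<^sup>2 + 2 * lam x * e) - y) / v x"
  shows "hit_time v a x y (Suc x) e = ereal s" "0 < s" "y < 0 \<Longrightarrow> - y / v x < s"
    "y + v x * s = sqrt ((max y 0)\<^sup>2 + 2 * lam x * e)"
proof -
  note v = v_pos[OF x] and l = lam_pos[OF x]
  define \<rho> where "\<rho> = sqrt ((max y 0)\<^sup>2 + 2 * lam x * e)"
  have \<rho>2: "\<rho>\<^sup>2 = (max y 0)\<^sup>2 + 2 * lam x * e"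
    unfolding \<rho>_def using l e by simp
  have \<rho>: "max y 0 < \<rho>"
    unfolding \<rho>_def using l e by (intro real_less_rsqrt) simp
  have s: "y + v x * s = \<rho>" unfolding s_def \<rho>_def using v by simp
  then show "y + v x * s = sqrt ((max y 0)\<^sup>2 + 2 * lam x * e)" by (simp add: \<rho>_def)
  have "0 < v x * s" using s \<rho> by linarith
  then show s0: "0 < s" using v by (simp add: zero_less_mult_iff)
  show "- y / v x < s" if "y < 0"
    unfolding s_def using v \<rho> \<rho>_def by (intro divide_strict_right_mono) auto
  show "hit_time v a x y (Suc x) e = ereal s"
  proof (rule hit_time_eq[OF s0])
    show "integral {0..s} (\<lambda>r. a x (Suc x) (y + v x * r)) = e"
    proof -
      have "max \<rho> 0 = \<rho>" using \<rho> by simp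
      then show ?thesis
        unfolding integral_rate_up[OF x less_imp_le[OF s0]] s using \<rho>2 l by simp
    qed
    fix r assume r: "0 < r" "r < s"
    have "v x * r < v x * s" using v r by simp
    then have "max (y + v x * r) 0 < \<rho>" using s \<rho> by auto
    then have "(max (y + v x * r) 0)\<^sup>2 < \<rho>\<^sup>2" by (intro power_strict_mono) auto
    then show "integral {0..r} (\<lambda>r. a x (Suc x) (y + v x * r)) < e"
      unfolding integral_rate_up[OF x less_imp_le[OF r(1)]]
      using \<rho>2 l by (simp add: pos_divide_less_eq mult.commute mult.left_commute)
  qed
qed

text \<open>The intensity left before the memory turns nonnegative is
  \<open>y^2 / (2 * \<mu> i)\<close>; if \<open>e\<close> is smaller, the clock rings strictly
  before the zero at \<open>- y / v (Suc i)\<close>.\<close>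

lemma hit_time_down:
  fixes y e :: real
  assumes x: "Suc i \<le> N0" and y: "y < 0" and e: "0 < e" "2 * \<mu> i * e < y\<^sup>2"
  defines "s \<equiv> (- sqrt (y\<^sup>2 - 2 * \<mu> i * e) - y) / v (Suc i)"
  shows "hit_time v a (Suc i) y i e = ereal s" "0 < s" "s < - y / v (Suc i)"
    "y + v (Suc i) * s = - sqrt (y\<^sup>2 - 2 * \<mu> i * e)"
proof -
  note v = v_pos[OF x]
  have m: "0 < \<mu> i" using \<mu>_pos x by simp
  define \<rho> where "\<rho> = sqrt (y\<^sup>2 - 2 * \<mu> i * e)"
  have \<rho>2: "\<rho>\<^sup>2 = y\<^sup>2 - 2 * \<mu> i * e"
    unfolding \<rho>_def using e by simp
  have \<rho>: "0 < \<rho>" unfolding \<rho>_def using e by simp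
  have "\<rho>\<^sup>2 < (- y)\<^sup>2" using \<rho>2 mult_pos_pos[OF m e(1)] by (simp add: mult.commute)
  then have \<rho>y: "\<rho> < - y" by (rule power2_less_imp_less) (use y in simp)
  have s: "y + v (Suc i) * s = - \<rho>" unfolding s_def \<rho>_def using v by simp
  then show "y + v (Suc i) * s = - sqrt (y\<^sup>2 - 2 * \<mu> i * e)" by (simp add: \<rho>_def)
  have "0 < v (Suc i) * s" using s \<rho>y by linarith
  then show s0: "0 < s" using v by (simp add: zero_less_mult_iff)
  show "s < - y / v (Suc i)"
    unfolding s_def using v \<rho> \<rho>_def by (intro divide_strict_right_mono) auto
  show "hit_time v a (Suc i) y i e = ereal s"
  proof (rule hit_time_eq[OF s0])
    show "integral {0..s} (\<lambda>r. a (Suc i) i (y + v (Suc i) * r)) = e"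
    proof -
      have "max (- (- \<rho>)) 0 = \<rho>" "max (- y) 0 = - y" using \<rho> y by simp_all
      then show ?thesis
        unfolding integral_rate_down[OF x less_imp_le[OF s0]] s using \<rho>2 m by simp
    qed
    fix r assume r: "0 < r" "r < s"
    have "v (Suc i) * r < v (Suc i) * s" using v r by simp
    then have "\<rho> < max (- (y + v (Suc i) * r)) 0" using s \<rho> by auto
    then have "\<rho>\<^sup>2 < (max (- (y + v (Suc i) * r)) 0)\<^sup>2" using \<rho> by (intro power_strict_mono) auto
    moreover have "(max (- y) 0)\<^sup>2 = y\<^sup>2" using y by (simp add: max_def)
    ultimately have "(max (- y) 0)\<^sup>2 - (max (- (y + v (Suc i) * r)) 0)\<^sup>2 < 2 * \<mu> i * e"
      using \<rho>2 by linarith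
    then show "integral {0..r} (\<lambda>r. a (Suc i) i (y + v (Suc i) * r)) < e"
      unfolding integral_rate_down[OF x less_imp_le[OF r(1)]]
      using m by (simp add: pos_divide_less_eq mult.commute mult.left_commute)
  qed
qed

text \<open>The squared negative part is \<open>2 * \<mu> i\<close> times all the intensity this
  clock can ever collect, because the memory increases and the rate vanishes once it is
  nonnegative.\<close>

lemma hit_time_down_infinity:
  assumes x: "Suc i \<le> N0" and e: "(max (- y) 0)\<^sup>2 < 2 * \<mu> i * e"
  shows "hit_time v a (Suc i) y i e = \<infinity>"
proof (rule hit_time_eq_infinity)
  fix r :: real assume r: "0 < r"
  have m: "0 < \<mu> i" using \<mu>_pos x by simp
  have "(max (- y) 0)\<^sup>2 - (max (- (y + v (Suc i) * r)) 0)\<^sup>2 < 2 * \<mu> i * e"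
    using e zero_le_power2[of "max (- (y + v (Suc i) * r)) 0"] by linarith
  then show "integral {0..r} (\<lambda>r. a (Suc i) i (y + v (Suc i) * r)) < e"
    unfolding integral_rate_down[OF x less_imp_le[OF r]]
    using m by (simp add: pos_divide_less_eq mult.commute mult.left_commute)
qed

lemma hit_time_none:
  assumes "j \<noteq> Suc x" "x \<noteq> Suc j" "0 < e"
  shows "hit_time v a x y j e = \<infinity>"
  using assms by (intro hit_time_eq_infinity) (simp add: rateN_def)

text \<open>The descent clock rings before the memory reaches 0, the ascent clock only afterwards,
  and no other clock rings at all.\<close>

lemma jump_step_down:
  assumes x: "Suc i \<le> N0" and y: "y < 0" and e: "\<And>j. 0 < e j" "2 * \<mu> i * e i < y\<^sup>2"
  shows "\<exists>s>0. jump_step n v a (Suc i, y, ereal T) e = (i, - sqrt (y\<^sup>2 - 2 * \<mu> i * e i), ereal (T + s))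
    \<and> - sqrt (y\<^sup>2 - 2 * \<mu> i * e i) = y + v (Suc i) * s"
proof -
  note down = hit_time_down[OF x y e(1) e(2)]
  note up = hit_time_up[OF x e(1), of y "Suc (Suc i)"]
  let ?s = "(- sqrt (y\<^sup>2 - 2 * \<mu> i * e i) - y) / v (Suc i)"
  have "jump_step n v a (Suc i, y, ereal T) e = (i, y + v (Suc i) * ?s, ereal T + ereal ?s)"
  proof (rule jump_step_eq[where e=e, OF _ down(1)])
    show "i \<le> n" using x N0_less by simp
    fix j assume j: "j \<le> n" "j \<noteq> i"
    show "ereal ?s < hit_time v a (Suc i) y j (e j)"
    proof (cases "j = Suc (Suc i)")
      case True
      have "?s < (sqrt ((max y 0)\<^sup>2 + 2 * lam (Suc i) * e j) - y) / v (Suc i)"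
        using down(3) up(3)[OF y] unfolding True by (rule less_trans)
      then show ?thesis using up(1) unfolding True by simp
    next
      case False
      then show ?thesis using j e(1)[of j] by (subst hit_time_none) auto
    qed
  qed
  then show ?thesis
    using down(2,4) by (intro exI[of _ ?s]) simp
qed

text \<open>Serves the jump at the reversal, where \<open>y < 0\<close> and too little intensity is
  left for a descent, as well as the later jumps with positive memory. At state 0 the condition on
  descents is vacuous.\<close>

lemma jump_step_up:
  assumes x: "x \<le> N0" and e: "\<And>j. 0 < e j" "\<And>i. x = Suc i \<Longrightarrow> (max (- y) 0)\<^sup>2 < 2 * \<mu> i * e i"
  shows "\<exists>s>0. jump_step n v a (x, y, ereal T) e =
      (Suc x, sqrt ((max y 0)\<^sup>2 + 2 * lam x * e (Suc x)), ereal (T + s))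
    \<and> sqrt ((max y 0)\<^sup>2 + 2 * lam x * e (Suc x)) = y + v x * s"
proof -
  note up = hit_time_up[OF x e(1), of y "Suc x"]
  let ?s = "(sqrt ((max y 0)\<^sup>2 + 2 * lam x * e (Suc x)) - y) / v x"
  have "jump_step n v a (x, y, ereal T) e = (Suc x, y + v x * ?s, ereal T + ereal ?s)"
  proof (rule jump_step_eq[where e=e, OF _ up(1)])
    show "Suc x \<le> n" using x N0_less by simp
    fix j assume j: "j \<le> n" "j \<noteq> Suc x"
    show "ereal ?s < hit_time v a x y j (e j)"
    proof (cases "x = Suc j")
      case True
      then show ?thesis using hit_time_down_infinity[of j y "e j"] x e(2)[of j] by simp
    next
      case False
      then show ?thesis using j e(1)[of j] by (subst hit_time_none) auto
    qed
  qed
  then show ?thesis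
    using up(2,4) by (intro exI[of _ ?s]) simp
qed

lemma chain_last_time:
  assumes "\<And>j. 0 < \<omega> k j"
  shows "snd (snd (chain n v a x0 y0 \<omega> k)) = ereal T \<Longrightarrow> ereal T < snd (snd (chain n v a x0 y0 \<omega> (Suc k)))"
proof -
  assume T: "snd (snd (chain n v a x0 y0 \<omega> k)) = ereal T"
  obtain x y where xy: "chain n v a x0 y0 \<omega> k = (x, y, ereal T)"
    using T by (metis prod.collapse)
  define m where "m = Min ((\<lambda>j. hit_time v a x y j (\<omega> k j)) ` {..n})"
  have "0 < m"
    unfolding m_def using assms by (subst Min_gr_iff) (auto intro!: hit_time_pos continuous_on_rateN)
  moreover have "snd (snd (chain n v a x0 y0 \<omega> (Suc k))) = ereal T + m"
    by (simp add: xy jump_step_def Let_def m_def)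
  ultimately show ?thesis by (cases m) auto
qed

text \<open>Squared memory: on the way down it decreases by \<open>2 \<mu>\<^sub>i e\<close> at the jump from \<open>i + 1\<close> to \<open>i\<close>, and \<open>G\<close> is
  the last level reached while it is positive; on the way up it increases by \<open>2 \<lambda>\<^sub>i e\<close>.
  The clocks used on the way down and up sit at distinct coordinates of \<open>\<omega>\<close>.\<close>
definition R :: "real \<Rightarrow> (nat \<Rightarrow> nat \<Rightarrow> real) \<Rightarrow> nat \<Rightarrow> real" where
  "R l \<omega> j = l\<^sup>2 - 2 * (\<Sum>i\<in>{j..<N0}. \<mu> i * \<omega> (N0 - 1 - i) i)"

definition U :: "nat \<Rightarrow> (nat \<Rightarrow> nat \<Rightarrow> real) \<Rightarrow> nat \<Rightarrow> real" where
  "U G \<omega> x = 2 * (\<Sum>i\<in>{G..<x}. lam i * \<omega> (N0 + i - 2 * G) (Suc i))"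

lemma R_step: "i < N0 \<Longrightarrow> R l \<omega> i = R l \<omega> (Suc i) - 2 * \<mu> i * \<omega> (N0 - 1 - i) i"
  unfolding R_def by (simp add: sum.atLeast_Suc_lessThan algebra_simps)

lemma U_step: "G \<le> x \<Longrightarrow> U G \<omega> (Suc x) = U G \<omega> x + 2 * lam x * \<omega> (N0 + x - 2 * G) (Suc x)"
  unfolding U_def by (simp add: algebra_simps)

lemma U_nonneg:
  assumes "\<And>k j. 0 < \<omega> k j" "x \<le> Suc N0"
  shows "0 \<le> U G \<omega> x"
proof -
  have "0 \<le> lam i" if "i \<in> {G..<x}" for i
    using lam_pos[of i] that assms(2) by (simp add: less_imp_le)
  then show ?thesis
    unfolding U_def using assms(1) by (auto intro!: sum_nonneg mult_nonneg_nonneg simp: less_imp_le)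
qed

text \<open>Purely pathwise: states \<open>X\<close> and memories \<open>Y\<close> are proposed for
  the first \<open>K\<close> jumps and checked one jump at a time; both stopping times are then read
  off through \<open>chain_times\<close>.\<close>

lemma process_at_reversal_and_exit:
  assumes \<omega>: "\<And>k j. 0 < \<omega> k j" and l: "l < 0" and G: "G \<le> N0" "\<And>j. G \<le> j \<Longrightarrow> j \<le> N0 \<Longrightarrow> 0 < R l \<omega> j"
    "\<And>i. G = Suc i \<Longrightarrow> R l \<omega> i < 0"
  shows "Xproc n v a N0 l \<omega> (rev_time n v a N0 l \<omega>) = G"
    "Lproc n v a N0 l \<omega> (exit_time n v a N0 l {..N0} \<omega>) = sqrt (U G \<omega> (Suc N0))"
proof -
  define m where "m = N0 - G"
  \<comment> \<open>There are \<open>m\<close> descents from \<open>N0\<close> to \<open>G\<close>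
    and \<open>m + 1\<close> ascents from \<open>G\<close> to \<open>Suc N0\<close>, the first state
    outside the layer.\<close>
  define K where "K = Suc (2 * m)"
  define X where "X k = (if k \<le> m then N0 - k else k + G - m)" for k
  \<comment> \<open>The memory right after jump \<open>k\<close>: at \<open>k = m\<close> it is
    still negative, so the root of \<open>U\<close> starts only with the first ascent.\<close>
  define Y where "Y k = (if k \<le> m then - sqrt (R l \<omega> (N0 - k)) else sqrt (U G \<omega> (X k)))" for k
  define t where "t k = real_of_ereal (snd (snd (chain n v a N0 l \<omega> k)))" for k
  have m: "m \<le> N0" "G = N0 - m" using G(1) by (auto simp: m_def)
  have X_le: "X k \<le> N0" if "k < K" for k
    using that m by (auto simp: X_def K_def)
  have Y_neg: "Y k < 0" if "k \<le> m" for k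
    using G(2)[of "N0 - k"] that m by (simp add: Y_def)
  have step: "\<exists>s>0. jump_step n v a (X k, Y k, ereal \<tau>) (\<omega> k) = (X (Suc k), Y (Suc k), ereal (\<tau> + s))
      \<and> Y (Suc k) = Y k + v (X k) * s" if k: "k < K" for k \<tau>
  proof (cases "k < m")
    case True
    \<comment> \<open>Jump number \<open>k\<close> leads from \<open>N0 - k\<close> to
      \<open>N0 - Suc k\<close>, which explains the row \<open>N0 - 1 - i\<close> in
      \<open>R\<close>.\<close>
    define i where "i = N0 - Suc k"
    have i: "X k = Suc i" "X (Suc k) = i" "Suc i \<le> N0" "N0 - k = Suc i" "N0 - Suc k = i" "N0 - 1 - i = k"
      using True m by (auto simp: X_def i_def)
    have R: "0 < R l \<omega> (Suc i)" "0 < R l \<omega> i"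
      using G(2)[of "Suc i"] G(2)[of i] True m by (auto simp: i_def)
    have Y: "Y k = - sqrt (R l \<omega> (Suc i))" "Y (Suc k) = - sqrt (R l \<omega> i)"
      using True i by (auto simp: Y_def)
    have Y2: "(Y k)\<^sup>2 = R l \<omega> (Suc i)" using R by (simp add: Y)
    have R': "(Y k)\<^sup>2 - 2 * \<mu> i * \<omega> k i = R l \<omega> i"
      unfolding Y2 using R_step[of i l \<omega>] i by simp
    have "2 * \<mu> i * \<omega> k i < (Y k)\<^sup>2" using R' R by linarith
    from jump_step_down[where e="\<omega> k", OF i(3) Y_neg[OF less_imp_le[OF True]] \<omega> this, of \<tau>]
    show ?thesis unfolding R' i(1,2) Y(2) .
  next
    case False
    have x: "X k \<le> N0" using X_le k by simp
    have X_Suc: "X (Suc k) = Suc (X k)" using False m by (cases "k = m") (auto simp: X_def)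
    \<comment> \<open>Jump \<open>k\<close> is preceded by \<open>N0 - G\<close> descents and
      \<open>X k - G\<close> ascents, which explains the row in \<open>U\<close>.\<close>
    have idx: "G \<le> X k" "N0 + X k - 2 * G = k" using False k m by (auto simp: X_def K_def)
    have U: "U G \<omega> (Suc (X k)) = U G \<omega> (X k) + 2 * lam (X k) * \<omega> k (Suc (X k))"
      using U_step[OF idx(1), of \<omega>] idx(2) by simp
    have Y_Suc: "Y (Suc k) = sqrt (U G \<omega> (Suc (X k)))"
      using False by (simp add: Y_def X_Suc)
    have Y: "(max (Y k) 0)\<^sup>2 = U G \<omega> (X k)"
    proof (cases "k = m")
      case True
      then have "X k = G" using m by (simp add: X_def)
      then show ?thesis using Y_neg[of k] True by (simp add: U_def max_def)
    next
      case False
      with \<open>\<not> k < m\<close> have "Y k = sqrt (U G \<omega> (X k))" by (simp add: Y_def)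
      then show ?thesis using U_nonneg[of \<omega> "X k" G, OF \<omega>] x by simp
    qed
    \<comment> \<open>At level \<open>G\<close> a descent is blocked because \<open>R\<close> would
      become negative; at later jumps because the memory is nonnegative and the downward rate is
      0.\<close>
    have down: "(max (- Y k) 0)\<^sup>2 < 2 * \<mu> i * \<omega> k i" if i: "X k = Suc i" for i
    proof (cases "k = m")
      case True
      then have Gi: "G = Suc i" "N0 - k = Suc i" "N0 - 1 - i = k" using m i by (auto simp: X_def)
      have "(max (- Y k) 0)\<^sup>2 = R l \<omega> (Suc i)"
        using G(2)[of "Suc i"] True Gi x i by (simp add: Y_def)
      moreover have "R l \<omega> i = R l \<omega> (Suc i) - 2 * \<mu> i * \<omega> k i"
        using R_step[of i l \<omega>] Gi x i by simp
      ultimately show ?thesis using G(3)[OF Gi(1)] by linarith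
    next
      case False
      with \<open>\<not> k < m\<close> have "Y k = sqrt (U G \<omega> (X k))" by (simp add: Y_def)
      then have "max (- Y k) 0 = 0" using U_nonneg[of \<omega> "X k" G, OF \<omega>] x by simp
      then show ?thesis using \<mu>_pos[of i] i x \<omega> by simp
    qed
    from jump_step_up[OF x, of "\<omega> k" "Y k" \<tau>, OF \<omega> down]
    show ?thesis unfolding Y U[symmetric] X_Suc Y_Suc by simp
  qed
  have chain: "chain n v a N0 l \<omega> k = (X k, Y k, ereal (t k))" if "k \<le> K" for k
    using that
  proof (induction k)
    case 0
    have "Y 0 = l" using l by (simp add: Y_def R_def)
    then show ?case by (simp add: X_def t_def zero_ereal_def)
  next
    case (Suc k)
    then have IH: "chain n v a N0 l \<omega> k = (X k, Y k, ereal (t k))" and k: "k < K" by auto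
    from step[OF k, of "t k"] obtain s
      where s: "jump_step n v a (X k, Y k, ereal (t k)) (\<omega> k) = (X (Suc k), Y (Suc k), ereal (t k + s))" by auto
    have "chain n v a N0 l \<omega> (Suc k) = (X (Suc k), Y (Suc k), ereal (t k + s))"
      using s IH by simp
    then show ?case by (simp add: t_def)
  qed
  have times: "t k < t (Suc k) \<and> Y (Suc k) = Y k + v (X k) * (t (Suc k) - t k)" if k: "k < K" for k
  proof -
    from step[OF k, of "t k"] obtain s where s: "0 < s"
      "jump_step n v a (X k, Y k, ereal (t k)) (\<omega> k) = (X (Suc k), Y (Suc k), ereal (t k + s))"
      "Y (Suc k) = Y k + v (X k) * s" by auto
    have "chain n v a N0 l \<omega> (Suc k) = (X (Suc k), Y (Suc k), ereal (t k + s))"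
      using s chain[of k] k by simp
    then have "t (Suc k) = t k + s" using chain[of "Suc k"] k by simp
    then show ?thesis using s by simp
  qed
  interpret P: chain_times n v a N0 l \<omega> K X Y t
  proof
    show "ereal (t K) < snd (snd (chain n v a N0 l \<omega> (Suc K)))"
      by (rule chain_last_time[OF \<omega>]) (simp only: chain[OF order_refl] snd_conv)
  qed (use chain times in auto)
  have X_K: "X K = Suc N0" using m by (auto simp: X_def K_def)
  have mK: "m < K" by (simp add: K_def)
  have "X (Suc m) = Suc G" using m by (simp add: X_def)
  then have "0 < Y (Suc m)"
    using lam_pos[OF G(1)] \<omega> by (simp add: Y_def U_def)
  then have rev: "t m \<le> rev_time n v a N0 l \<omega>" "rev_time n v a N0 l \<omega> < t (Suc m)"
    using P.rev_time_eq[OF mK] v_pos X_le Y_neg times mK by (auto simp: K_def)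
  have "Xproc n v a N0 l \<omega> (rev_time n v a N0 l \<omega>) = X m"
    by (rule P.process_eq_before(1)[OF mK rev])
  also have "\<dots> = G" using m by (simp add: X_def)
  finally show "Xproc n v a N0 l \<omega> (rev_time n v a N0 l \<omega>) = G" .
  have "0 \<le> rev_time n v a N0 l \<omega>" "rev_time n v a N0 l \<omega> \<le> t K"
    using rev P.t_le[of 0 m] P.t_le[of "Suc m" K] P.t_0 mK by auto
  then have "exit_time n v a N0 l {..N0} \<omega> = t K"
    using X_le X_K by (intro P.exit_time_eq) auto
  then have "Lproc n v a N0 l \<omega> (exit_time n v a N0 l {..N0} \<omega>) = Y K"
    using P.process_eq(2)[of K "t K"] P.t_last by simp
  also have "\<dots> = sqrt (U G \<omega> (Suc N0))"
    using mK X_K by (simp add: Y_def)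
  finally show "Lproc n v a N0 l \<omega> (exit_time n v a N0 l {..N0} \<omega>) = sqrt (U G \<omega> (Suc N0))" .
qed

end

section \<open>Laws of the reversal state and of the memory at exit\<close>

interpretation Omega: prob_space Omega
  unfolding Omega_def by (intro prob_space_PiM prob_space_Exp1)

text \<open>\<open>Omega\<close> is a product of products, so the cylinder formula is applied twice:
  over the rows that \<open>J\<close> meets and, within each row, over the columns that it meets
  there.\<close>

lemma emeasure_Omega_coordinates:
  assumes J: "finite J" and F: "\<And>k j. (k, j) \<in> J \<Longrightarrow> F k j \<in> sets Exp1"
  shows "emeasure Omega {\<omega>. \<forall>(k, j)\<in>J. \<omega> k j \<in> F k j} = (\<Prod>(k, j)\<in>J. emeasure Exp1 (F k j))"
proof -
  interpret row: product_prob_space "\<lambda>_::nat. Exp1" UNIV ..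
  interpret product_prob_space "\<lambda>_::nat. PiM UNIV (\<lambda>_::nat. Exp1)" UNIV
    by unfold_locales
  define B where "B k = {e \<in> space (PiM UNIV (\<lambda>_::nat. Exp1)). \<forall>j\<in>J `` {k}. e j \<in> F k j}" for k
  have fin: "finite (J `` {k})" for k
    using J by (rule finite_Image)
  have "emeasure Omega {\<omega>. \<forall>(k, j)\<in>J. \<omega> k j \<in> F k j} =
    emeasure Omega {\<omega> \<in> space (PiM UNIV (\<lambda>_::nat. PiM UNIV (\<lambda>_::nat. Exp1))). \<forall>k\<in>fst ` J. \<omega> k \<in> B k}"
    by (rule arg_cong[where f="emeasure Omega"]) (auto simp: B_def space_PiM PiE_def)
  also have "\<dots> = (\<Prod>k\<in>fst ` J. emeasure (PiM UNIV (\<lambda>_. Exp1)) (B k))"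
    unfolding Omega_def
  proof (rule emeasure_PiM_Collect)
    fix k
    have component: "(\<lambda>e. e j) \<in> measurable (PiM UNIV (\<lambda>_::nat. Exp1)) Exp1" for j
      by (rule measurable_component_singleton) simp
    have "(\<lambda>e. e j) -` F k j \<inter> space (PiM UNIV (\<lambda>_. Exp1)) \<in> sets (PiM UNIV (\<lambda>_. Exp1))" if "(k, j) \<in> J" for j
      by (rule measurable_sets[OF component F[OF that]])
    then have "{e \<in> space (PiM UNIV (\<lambda>_::nat. Exp1)). e j \<in> F k j} \<in> sets (PiM UNIV (\<lambda>_. Exp1))" if "j \<in> J `` {k}" for j
      using that by (simp add: vimage_def Int_def conj_commute)
    then show "B k \<in> sets (PiM UNIV (\<lambda>_. Exp1))"
      unfolding B_def by (rule sets.sets_Collect_finite_All) (simp_all add: fin)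
  qed (use J in auto)
  also have "\<dots> = (\<Prod>k\<in>fst ` J. \<Prod>j\<in>J `` {k}. emeasure Exp1 (F k j))"
    unfolding B_def by (intro prod.cong refl row.emeasure_PiM_Collect fin subset_UNIV F) auto
  also have "\<dots> = (\<Prod>(k, j)\<in>Sigma (fst ` J) (\<lambda>k. J `` {k}). emeasure Exp1 (F k j))"
    using J fin by (intro prod.Sigma) auto
  also have "Sigma (fst ` J) (\<lambda>k. J `` {k}) = J"
    by force
  finally show ?thesis .
qed

text \<open>The laws agree on cylinders, where injectivity turns a product over the image of
  \<open>J\<close> into one over \<open>J\<close>. The index type is free so that \<open>h\<close>
  may also be the identity on pairs, which yields independence of the whole array.\<close>

lemma distr_Omega_coordinates:
  fixes h :: "'i \<Rightarrow> nat \<times> nat"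
  assumes h: "inj h"
  shows "distr Omega (PiM UNIV (\<lambda>_. Exp1)) (\<lambda>\<omega> i. \<omega> (fst (h i)) (snd (h i))) = PiM UNIV (\<lambda>_. Exp1)"
proof -
  interpret product_prob_space "\<lambda>_::'i. Exp1" UNIV ..
  have meas: "(\<lambda>\<omega> i. \<omega> (fst (h i)) (snd (h i))) \<in> measurable Omega (PiM UNIV (\<lambda>_. Exp1))"
  proof (rule measurable_PiM_single')
    show "(\<lambda>\<omega>. \<omega> (fst (h i)) (snd (h i))) \<in> measurable Omega Exp1" for i
      by (simp cong: measurable_cong_sets add: measurable_Omega_component)
  qed auto
  show ?thesis
  proof (rule PiM_eq)
    fix J :: "'i set" and F assume J: "finite J" and F: "\<And>j. j \<in> J \<Longrightarrow> F j \<in> sets Exp1"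
    have "emeasure (distr Omega (PiM UNIV (\<lambda>_. Exp1)) (\<lambda>\<omega> i. \<omega> (fst (h i)) (snd (h i))))
        (prod_emb UNIV (\<lambda>_. Exp1) J (Pi\<^sub>E J F)) =
      emeasure Omega ((\<lambda>\<omega> i. \<omega> (fst (h i)) (snd (h i))) -` prod_emb UNIV (\<lambda>_. Exp1) J (Pi\<^sub>E J F) \<inter> space Omega)"
      using J F by (intro emeasure_distr meas sets_PiM_I) auto
    also have "(\<lambda>\<omega> i. \<omega> (fst (h i)) (snd (h i))) -` prod_emb UNIV (\<lambda>_. Exp1) J (Pi\<^sub>E J F) \<inter> space Omega =
      {\<omega>. \<forall>(k, j)\<in>h ` J. \<omega> k j \<in> F (the_inv h (k, j))}"
      using h by (auto simp: prod_emb_def PiE_iff the_inv_f_f split_beta)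
    also have "emeasure Omega \<dots> = (\<Prod>(k, j)\<in>h ` J. emeasure Exp1 (F (the_inv h (k, j))))"
      using J F h by (intro emeasure_Omega_coordinates) (auto simp: the_inv_f_f)
    also have "\<dots> = (\<Prod>j\<in>J. emeasure Exp1 (F j))"
      using h by (subst prod.reindex) (auto simp: the_inv_f_f split_beta intro: inj_on_subset)
    finally show "emeasure (distr Omega (PiM UNIV (\<lambda>_. Exp1)) (\<lambda>\<omega> i. \<omega> (fst (h i)) (snd (h i))))
        (prod_emb UNIV (\<lambda>_. Exp1) J (Pi\<^sub>E J F)) = (\<Prod>j\<in>J. emeasure Exp1 (F j))" .
  qed simp
qed

lemma measurable_Omega_select:
  fixes h :: "nat \<Rightarrow> nat \<times> nat"
  shows "(\<lambda>\<omega> i. \<omega> (fst (h i)) (snd (h i))) \<in> measurable Omega OmegaE"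
  unfolding OmegaE_def
proof (rule measurable_PiM_single')
  show "(\<lambda>\<omega>. \<omega> (fst (h i)) (snd (h i))) \<in> measurable Omega Exp1" for i
    by (simp cong: measurable_cong_sets add: measurable_Omega_component)
qed auto

lemma distr_Omega_select:
  fixes h :: "nat \<Rightarrow> nat \<times> nat"
  assumes "inj h"
  shows "distr Omega OmegaE (\<lambda>\<omega> i. \<omega> (fst (h i)) (snd (h i))) = OmegaE"
  unfolding OmegaE_def by (rule distr_Omega_coordinates[OF assms])

lemma distr_Omega_component: "distr Omega Exp1 (\<lambda>\<omega>. \<omega> k j) = Exp1"
proof -
  have "emeasure (distr Omega Exp1 (\<lambda>\<omega>. \<omega> k j)) A = emeasure Exp1 A" if A: "A \<in> sets Exp1" for A
  proof -
    have "emeasure (distr Omega Exp1 (\<lambda>\<omega>. \<omega> k j)) A = emeasure Omega ((\<lambda>\<omega>. \<omega> k j) -` A \<inter> space Omega)"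
      using A by (intro emeasure_distr) (simp_all cong: measurable_cong_sets add: measurable_Omega_component)
    also have "(\<lambda>\<omega>. \<omega> k j) -` A \<inter> space Omega = {\<omega>. \<forall>(k, j)\<in>{(k, j)}. \<omega> k j \<in> A}"
      by auto
    also have "emeasure Omega \<dots> = emeasure Exp1 A"
      using A by (subst emeasure_Omega_coordinates) auto
    finally show ?thesis .
  qed
  then show ?thesis by (intro measure_eqI) auto
qed

lemma AE_Omega_pos: "AE \<omega> in Omega. \<forall>k j. 0 < \<omega> k j"
proof -
  have "AE \<omega> in Omega. 0 < \<omega> k j" for k j
  proof (rule AE_distrD[of "\<lambda>\<omega>. \<omega> k j" Omega Exp1 "\<lambda>x. 0 < x"])
    show "(\<lambda>\<omega>. \<omega> k j) \<in> measurable Omega Exp1"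
      by (simp cong: measurable_cong_sets add: measurable_Omega_component)
    show "AE x in distr Omega Exp1 (\<lambda>\<omega>. \<omega> k j). 0 < x"
      unfolding distr_Omega_component by (rule AE_Exp1_pos)
  qed
  then show ?thesis by (simp add: AE_all_countable)
qed

lemma indep_vars_Omega: "Omega.indep_vars (\<lambda>_. Exp1) (\<lambda>p \<omega>. \<omega> (fst p) (snd p)) UNIV"
proof (subst Omega.indep_vars_iff_distr_eq_PiM)
  show "(\<lambda>\<omega>. \<omega> (fst p) (snd p)) \<in> measurable Omega Exp1" for p
    by (simp cong: measurable_cong_sets add: measurable_Omega_component)
  show "distr Omega (PiM UNIV (\<lambda>_. Exp1)) (\<lambda>\<omega>. \<lambda>p\<in>UNIV. \<omega> (fst p) (snd p)) =
    PiM UNIV (\<lambda>p. distr Omega Exp1 (\<lambda>\<omega>. \<omega> (fst p) (snd p)))"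
    using distr_Omega_coordinates[of "\<lambda>p. p"] by (simp add: distr_Omega_component restrict_def inj_def)
qed simp

lemma expectation_mult_Omega:
  fixes f g :: "(nat \<times> nat \<Rightarrow> real) \<Rightarrow> real"
  assumes AB: "A \<inter> B = {}"
    and f: "f \<in> borel_measurable (PiM A (\<lambda>_. Exp1))" and g: "g \<in> borel_measurable (PiM B (\<lambda>_. Exp1))"
    and bound: "\<And>x. \<bar>f x\<bar> \<le> C" "\<And>x. \<bar>g x\<bar> \<le> C"
  shows "Omega.expectation (\<lambda>\<omega>. f (\<lambda>p\<in>A. \<omega> (fst p) (snd p)) * g (\<lambda>p\<in>B. \<omega> (fst p) (snd p))) =
    Omega.expectation (\<lambda>\<omega>. f (\<lambda>p\<in>A. \<omega> (fst p) (snd p))) * Omega.expectation (\<lambda>\<omega>. g (\<lambda>p\<in>B. \<omega> (fst p) (snd p)))"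
proof -
  have "Omega.indep_var borel (f \<circ> (\<lambda>\<omega>. \<lambda>p\<in>A. \<omega> (fst p) (snd p))) borel (g \<circ> (\<lambda>\<omega>. \<lambda>p\<in>B. \<omega> (fst p) (snd p)))"
    by (rule Omega.indep_var_compose[OF Omega.indep_var_restrict[OF indep_vars_Omega AB subset_UNIV subset_UNIV] f g])
  then have indep: "Omega.indep_var borel (\<lambda>\<omega>. f (\<lambda>p\<in>A. \<omega> (fst p) (snd p))) borel (\<lambda>\<omega>. g (\<lambda>p\<in>B. \<omega> (fst p) (snd p)))"
    by (simp add: comp_def)
  note rv = Omega.indep_var_rv1[OF indep] Omega.indep_var_rv2[OF indep]
  show ?thesis
    by (rule Omega.indep_var_lebesgue_integral[OF indep];
        rule Omega.integrable_const_bound[of _ C]; use bound rv in simp)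
qed

text \<open>Zeros in place of a shift keep coefficient \<open>i\<close> attached to clock
  \<open>i\<close>, so the tails for different \<open>j\<close> are weighted sums of the same
  sequence.\<close>

definition tail_seq :: "nat \<Rightarrow> (nat \<Rightarrow> real) \<Rightarrow> nat \<Rightarrow> real" where
  "tail_seq j b i = (if i < j then 0 else b i)"

lemma summable_tail_seq:
  assumes "summable (\<lambda>i. \<bar>b i\<bar>)"
  shows "summable (\<lambda>i. \<bar>tail_seq j b i\<bar>)"
  by (rule summable_comparison_test[OF _ assms]) (auto simp: tail_seq_def)

lemma suminf_tail_seq_diff_le:
  assumes "summable (\<lambda>i. \<bar>a i - b i\<bar>)"
  shows "(\<Sum>i. \<bar>tail_seq j a i - tail_seq j b i\<bar>) \<le> (\<Sum>i. \<bar>a i - b i\<bar>)"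
proof (rule suminf_le[OF _ _ assms])
  show "summable (\<lambda>i. \<bar>tail_seq j a i - tail_seq j b i\<bar>)"
    by (rule summable_comparison_test[OF _ assms]) (auto simp: tail_seq_def)
qed (auto simp: tail_seq_def)

lemma suminf_tail_seq_tendsto_0:
  assumes "summable (\<lambda>i. \<bar>b i\<bar>)"
  shows "(\<lambda>j. \<Sum>i. \<bar>tail_seq j b i\<bar>) \<longlonglongrightarrow> 0"
proof -
  have "(\<Sum>i. \<bar>tail_seq j b i\<bar>) = (\<Sum>i. \<bar>b i\<bar>) - (\<Sum>i<j. \<bar>b i\<bar>)" for j
  proof -
    have "(\<Sum>i. \<bar>tail_seq j b i\<bar>) = (\<Sum>i. \<bar>tail_seq j b (i + j)\<bar>) + (\<Sum>i<j. \<bar>tail_seq j b i\<bar>)"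
      by (rule suminf_split_initial_segment[OF summable_tail_seq[OF assms]])
    also have "\<dots> = (\<Sum>i. \<bar>b (i + j)\<bar>)" by (simp add: tail_seq_def)
    also have "\<dots> = (\<Sum>i. \<bar>b i\<bar>) - (\<Sum>i<j. \<bar>b i\<bar>)"
      by (rule suminf_minus_initial_segment[OF assms])
    finally show ?thesis .
  qed
  moreover have "(\<lambda>j. (\<Sum>i. \<bar>b i\<bar>) - (\<Sum>i<j. \<bar>b i\<bar>)) \<longlonglongrightarrow> (\<Sum>i. \<bar>b i\<bar>) - (\<Sum>i. \<bar>b i\<bar>)"
    by (intro tendsto_diff tendsto_const summable_LIMSEQ assms)
  ultimately show ?thesis by simp
qed

text \<open>Returns to the shifted form used in the limit law; splitting off the first
  \<open>j\<close> terms relies on convergence at this particular \<open>E\<close>.\<close>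

lemma expsum_tail_seq:
  assumes "summable (\<lambda>i. \<bar>b i * E i\<bar>)"
  shows "expsum (tail_seq j b) E = (\<Sum>i. b (i + j) * E (i + j))"
proof -
  have "summable (\<lambda>i. tail_seq j b i * E i)"
    by (rule summable_comparison_test[OF _ assms]) (auto simp: tail_seq_def)
  from suminf_split_initial_segment[OF this, of j] show ?thesis
    unfolding expsum_def by (simp add: tail_seq_def)
qed

lemma expsum_tail_seq_finite:
  assumes "\<And>i. N \<le> i \<Longrightarrow> b i = 0"
  shows "expsum (tail_seq j b) E = (\<Sum>i\<in>{j..<N}. b i * E i)"
proof -
  have "expsum (tail_seq j b) E = (\<Sum>i\<in>{j..<N}. tail_seq j b i * E i)"
    unfolding expsum_def
    by (rule suminf_finite) (use assms in \<open>auto simp: tail_seq_def\<close>)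
  also have "\<dots> = (\<Sum>i\<in>{j..<N}. b i * E i)"
    by (intro sum.cong) (auto simp: tail_seq_def)
  finally show ?thesis .
qed

section \<open>Reversal state and exit memory as functions of weighted sums\<close>

lemma (in lower_layer) summable_mu: "summable (\<lambda>i. \<bar>\<mu> i\<bar>)"
  by (rule summable_finite[of "{..N0}"]) (auto simp: muN_def)

lemma (in lower_layer) summable_lam: "summable (\<lambda>i. \<bar>lam i\<bar>)"
  by (rule summable_finite[of "{..N0}"]) (auto simp: lamN_def)

context lower_layer
begin

text \<open>Coordinates of \<open>\<omega>\<close> carrying the clocks; indices without a clock get unused coordinates, which
  makes the maps injective on all of \<open>nat\<close>.\<close>
definition down_clock :: "nat \<Rightarrow> nat \<times> nat" where
  "down_clock i = (if i < N0 then (N0 - 1 - i, i) else (2 * N0 + 1 + i, 0))"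

definition up_clock :: "nat \<Rightarrow> nat \<Rightarrow> nat \<times> nat" where
  "up_clock G i = (if G \<le> i \<and> i \<le> N0 then (N0 + i - 2 * G, Suc i) else (2 * N0 + 1 + i, 0))"

text \<open>Used clocks sit in pairwise different columns and in rows up to \<open>2 * N0\<close>;
  spare positions sit in column 0 of pairwise different later rows.\<close>

lemma inj_down_clock: "inj down_clock"
  by (auto simp: inj_def down_clock_def split: if_splits)

lemma inj_up_clock: "G \<le> N0 \<Longrightarrow> inj (up_clock G)"
  by (auto simp: inj_def up_clock_def split: if_splits)

lemma R_eq_expsum: "R l \<omega> j = l\<^sup>2 - 2 * expsum (tail_seq j \<mu>) (\<lambda>i. \<omega> (fst (down_clock i)) (snd (down_clock i)))"
proof -
  have "expsum (tail_seq j \<mu>) (\<lambda>i. \<omega> (fst (down_clock i)) (snd (down_clock i))) =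
      (\<Sum>i\<in>{j..<N0}. \<mu> i * \<omega> (fst (down_clock i)) (snd (down_clock i)))"
    by (rule expsum_tail_seq_finite) (simp add: muN_def)
  then show ?thesis by (simp add: R_def down_clock_def)
qed

lemma U_eq_expsum: "U G \<omega> (Suc N0) = 2 * expsum (tail_seq G lam) (\<lambda>i. \<omega> (fst (up_clock G i)) (snd (up_clock G i)))"
proof -
  have "expsum (tail_seq G lam) (\<lambda>i. \<omega> (fst (up_clock G i)) (snd (up_clock G i))) =
      (\<Sum>i\<in>{G..<Suc N0}. lam i * \<omega> (fst (up_clock G i)) (snd (up_clock G i)))"
    by (rule expsum_tail_seq_finite) (simp add: lamN_def)
  also have "\<dots> = (\<Sum>i\<in>{G..<Suc N0}. lam i * \<omega> (N0 + i - 2 * G) (Suc i))"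
    by (intro sum.cong) (auto simp: up_clock_def)
  finally show ?thesis by (simp add: U_def)
qed

abbreviation "reversal_state l \<omega> \<equiv> Xproc n v a N0 l \<omega> (rev_time n v a N0 l \<omega>)"
abbreviation "exit_memory l \<omega> \<equiv> Lproc n v a N0 l \<omega> (exit_time n v a N0 l {..N0} \<omega>)"

lemma measurable_reversal_state [measurable]: "reversal_state l \<in> measurable Omega (count_space UNIV)"
  by (intro measurable_Xproc measurable_rev_time continuous_on_rateN rateN_nonneg)

lemma measurable_exit_memory [measurable]: "exit_memory l \<in> borel_measurable Omega"
  by (intro measurable_Lproc measurable_exit_time continuous_on_rateN rateN_nonneg)

lemma R_mono:
  assumes "\<And>k j. 0 < \<omega> k j" "i \<le> j"
  shows "R l \<omega> i \<le> R l \<omega> j"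
proof -
  have "(\<Sum>i\<in>{j..<N0}. \<mu> i * \<omega> (N0 - 1 - i) i) \<le> (\<Sum>i\<in>{i..<N0}. \<mu> i * \<omega> (N0 - 1 - i) i)"
    using assms \<mu>_pos by (intro sum_mono2) (auto intro!: mult_nonneg_nonneg less_imp_le)
  then show ?thesis by (simp add: R_def)
qed

text \<open>Excludes a descent clock that equals exactly the intensity left. The sum has no atom at
  the nonzero number \<open>l^2 / 2\<close>, and \<open>inj_down_clock\<close> transfers this to
  \<open>Omega\<close>.\<close>

lemma AE_R_neq_0:
  assumes "l \<noteq> 0"
  shows "AE \<omega> in Omega. \<forall>j. R l \<omega> j \<noteq> 0"
proof -
  have "AE \<omega> in Omega. R l \<omega> j \<noteq> 0" for j
  proof -
    have "AE E in OmegaE. expsum (tail_seq j \<mu>) E \<noteq> l\<^sup>2 / 2"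
      using assms by (intro AE_expsum_neq summable_tail_seq summable_mu) simp
    then have "AE E in distr Omega OmegaE (\<lambda>\<omega> i. \<omega> (fst (down_clock i)) (snd (down_clock i))). expsum (tail_seq j \<mu>) E \<noteq> l\<^sup>2 / 2"
      by (simp only: distr_Omega_select[OF inj_down_clock])
    from AE_distrD[OF measurable_Omega_select this]
    show ?thesis by eventually_elim (simp add: R_eq_expsum)
  qed
  then show ?thesis by (simp add: AE_all_countable)
qed

text \<open>The least \<open>j\<close> with positive \<open>R\<close> exists because
  \<open>R l \<omega> N0 = l^2\<close>. Monotonicity gives positivity above it, and nonvanishing
  gives strict negativity below, as the pathwise lemma requires.\<close>

lemma AE_reversal_and_exit:
  assumes l: "l < 0"
  shows "AE \<omega> in Omega. reversal_state l \<omega> \<le> N0 \<and> exit_memory l \<omega> = sqrt (U (reversal_state l \<omega>) \<omega> (Suc N0))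
    \<and> (\<forall>j. reversal_state l \<omega> \<le> j \<longleftrightarrow> 0 \<le> R l \<omega> j)"
proof -
  have "AE \<omega> in Omega. \<forall>j. R l \<omega> j \<noteq> 0"
    using l by (intro AE_R_neq_0) simp
  with AE_Omega_pos show ?thesis
  proof eventually_elim
    case (elim \<omega>)
    then have pos: "0 < \<omega> k j" and R: "R l \<omega> j \<noteq> 0" for k j by auto
    define G where "G = (LEAST j. 0 < R l \<omega> j)"
    have N0: "0 < R l \<omega> N0" using l by (simp add: R_def)
    then have G: "G \<le> N0" "0 < R l \<omega> G"
      unfolding G_def by (auto intro: Least_le LeastI)
    have up: "0 < R l \<omega> j" if "G \<le> j" for j
      using less_le_trans[OF G(2) R_mono[OF pos that]] .
    have down: "R l \<omega> i < 0" if "i < G" for i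
      using not_less_Least[OF that[unfolded G_def]] R[of i] by simp
    have "reversal_state l \<omega> = G" "exit_memory l \<omega> = sqrt (U G \<omega> (Suc N0))"
      using process_at_reversal_and_exit[of \<omega> l G, OF pos l G(1) up down] by simp_all
    moreover have "G \<le> j \<longleftrightarrow> 0 \<le> R l \<omega> j" for j
      using up[of j] down[of j] by (cases "G \<le> j") auto
    ultimately show ?case using G(1) by simp
  qed
qed

lemma prob_reversal_state_le:
  assumes l: "l < 0"
  shows "Omega.prob {\<omega>. reversal_state l \<omega> \<le> j} = OmegaE.prob {E. expsum (tail_seq j \<mu>) E \<le> l\<^sup>2 / 2}"
proof -
  let ?s = "\<lambda>\<omega> i. \<omega> (fst (down_clock i)) (snd (down_clock i)) :: real"
  have S: "{E \<in> space OmegaE. expsum (tail_seq j \<mu>) E \<le> l\<^sup>2 / 2} \<in> sets OmegaE"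
    by measurable
  have R: "{\<omega>. 0 \<le> R l \<omega> j} = ?s -` {E \<in> space OmegaE. expsum (tail_seq j \<mu>) E \<le> l\<^sup>2 / 2} \<inter> space Omega"
    by (auto simp: R_eq_expsum)
  have "{\<omega> \<in> space Omega. reversal_state l \<omega> \<le> j} \<in> sets Omega" by measurable
  moreover have "{\<omega>. 0 \<le> R l \<omega> j} \<in> sets Omega"
    unfolding R by (rule measurable_sets[OF measurable_Omega_select S])
  ultimately have "Omega.prob {\<omega>. reversal_state l \<omega> \<le> j} = Omega.prob {\<omega>. 0 \<le> R l \<omega> j}"
    using AE_reversal_and_exit[OF l] by (intro Omega.finite_measure_eq_AE) (auto elim: eventually_mono)
  also have "\<dots> = measure (distr Omega OmegaE ?s) {E \<in> space OmegaE. expsum (tail_seq j \<mu>) E \<le> l\<^sup>2 / 2}"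
    unfolding R by (rule measure_distr[symmetric, OF measurable_Omega_select S])
  also have "\<dots> = OmegaE.prob {E. expsum (tail_seq j \<mu>) E \<le> l\<^sup>2 / 2}"
    unfolding distr_Omega_select[OF inj_down_clock] by simp
  finally show ?thesis .
qed

lemma pN_eq:
  assumes l: "l < 0"
  shows "pN n N0 N1 v l j = OmegaE.prob {E. expsum (tail_seq j \<mu>) E \<le> l\<^sup>2 / 2} -
    (if j = 0 then 0 else OmegaE.prob {E. expsum (tail_seq (j - 1) \<mu>) E \<le> l\<^sup>2 / 2})"
proof -
  have meas: "{\<omega>. reversal_state l \<omega> \<le> i} \<in> sets Omega" for i
  proof -
    have "{\<omega> \<in> space Omega. reversal_state l \<omega> \<le> i} \<in> sets Omega" by measurable
    then show ?thesis by simp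
  qed
  have pN: "pN n N0 N1 v l j = Omega.prob {\<omega>. reversal_state l \<omega> = j}"
    by (simp add: pN_def)
  show ?thesis
  proof (cases j)
    case 0
    then show ?thesis unfolding pN using prob_reversal_state_le[OF l, of 0] by simp
  next
    case (Suc i)
    have "{\<omega>. reversal_state l \<omega> = j} = {\<omega>. reversal_state l \<omega> \<le> j} - {\<omega>. reversal_state l \<omega> \<le> i}"
      using Suc by auto
    then have "pN n N0 N1 v l j = Omega.prob {\<omega>. reversal_state l \<omega> \<le> j} - Omega.prob {\<omega>. reversal_state l \<omega> \<le> i}"
      unfolding pN using Suc meas by (simp only:) (rule Omega.finite_measure_Diff, auto)
    then show ?thesis
      using Suc by (simp add: prob_reversal_state_le[OF l])
  qed
qed

lemma pN_nonneg: "0 \<le> pN n N0 N1 v l j"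
  by (simp add: pN_def)

text \<open>The reversal state is a function of the downward clocks, hence independent of the upward ones.\<close>
lemma expectation_exit_memory:
  fixes f :: "real \<Rightarrow> real"
  assumes l: "l < 0" and [measurable]: "f \<in> borel_measurable borel" and bound: "\<And>x. \<bar>f x\<bar> \<le> 1"
  shows "(\<lambda>j. pN n N0 N1 v l j * OmegaE.expectation (\<lambda>E. f (sqrt (2 * expsum (tail_seq j lam) E))))
    sums Omega.expectation (\<lambda>\<omega>. f (exit_memory l \<omega>))"
proof -
  let ?up = "\<lambda>j \<omega> i. \<omega> (fst (up_clock j i)) (snd (up_clock j i)) :: real"
  \<comment> \<open>The positions of the descent clocks. For \<open>N0 = 0\<close> natural
    subtraction gives \<open>N0 - 1 = 0\<close>, and \<open>snd p < N0\<close> keeps the set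
    empty.\<close>
  let ?D = "{p :: nat \<times> nat. fst p + snd p = N0 - 1 \<and> snd p < N0}"
  \<comment> \<open>Reading \<open>R\<close> and \<open>U\<close> off arrays indexed by pairs allows
    restriction to a set of positions: the undefined values outside it do not enter the
    sums.\<close>
  define S where "S p = R l (curry p)" for p :: "nat \<times> nat \<Rightarrow> real"
  define W where "W j p = sqrt (U j (curry p) (Suc N0))" for j and p :: "nat \<times> nat \<Rightarrow> real"
  define B where "B j = up_clock j ` {j..N0}" for j
  \<comment> \<open>Almost surely the indicator of reversal at \<open>j\<close>, written so that it
    depends on the descent clocks alone.\<close>
  define I where "I j p = (if 0 \<le> S p j \<and> (j = 0 \<or> S p (j - 1) < 0) then 1 else 0 :: real)" for j p
  have S: "S (\<lambda>p\<in>?D. \<omega> (fst p) (snd p)) = R l \<omega>" for \<omega>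
    unfolding S_def R_def by (intro ext arg_cong2[where f=minus] arg_cong2[where f=times] sum.cong) auto
  have W: "W j (\<lambda>p\<in>B j. \<omega> (fst p) (snd p)) = sqrt (U j \<omega> (Suc N0))" for j \<omega>
  proof -
    have "(N0 + i - 2 * j, Suc i) \<in> B j" if "i \<in> {j..<Suc N0}" for i
      using that unfolding B_def by (intro image_eqI[of _ _ i]) (auto simp: up_clock_def)
    then show ?thesis
      unfolding W_def U_def by (intro arg_cong[where f=sqrt] arg_cong2[where f=times] sum.cong) auto
  qed
  have comp: "(\<lambda>x. x p) \<in> borel_measurable (PiM A (\<lambda>_. Exp1))" if "p \<in> A" for p and A :: "(nat \<times> nat) set"
    using measurable_component_singleton[OF that, of "\<lambda>_. Exp1"] by (simp cong: measurable_cong_sets)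
  have S_meas: "(\<lambda>p. S p j) \<in> borel_measurable (PiM ?D (\<lambda>_. Exp1))" for j
    unfolding S_def R_def curry_def
    by (intro borel_measurable_diff borel_measurable_times borel_measurable_const borel_measurable_sum comp) auto
  have W_meas: "W j \<in> borel_measurable (PiM (B j) (\<lambda>_. Exp1))" for j
  proof -
    have "(N0 + i - 2 * j, Suc i) \<in> B j" if "i \<in> {j..<Suc N0}" for i
      using that unfolding B_def by (intro image_eqI[of _ _ i]) (auto simp: up_clock_def)
    then have "(\<lambda>p. 2 * (\<Sum>i\<in>{j..<Suc N0}. lam i * p (N0 + i - 2 * j, Suc i))) \<in> borel_measurable (PiM (B j) (\<lambda>_. Exp1))"
      by (intro borel_measurable_times borel_measurable_const borel_measurable_sum comp)
    from measurable_compose[OF this borel_measurable_sqrt] show ?thesis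
      unfolding W_def[abs_def] U_def curry_def .
  qed
  have I_meas: "I j \<in> borel_measurable (PiM ?D (\<lambda>_. Exp1))" for j
  proof -
    note S_meas[measurable]
    show ?thesis unfolding I_def[abs_def] by measurable
  qed
  have I_AE: "AE \<omega> in Omega. indicator {\<omega>. reversal_state l \<omega> = j} \<omega> = I j (\<lambda>p\<in>?D. \<omega> (fst p) (snd p))" for j
    using AE_reversal_and_exit[OF l]
  proof eventually_elim
    case (elim \<omega>)
    have "reversal_state l \<omega> = j \<longleftrightarrow> reversal_state l \<omega> \<le> j \<and> (j = 0 \<or> \<not> reversal_state l \<omega> \<le> j - 1)"
      by auto
    also have "\<dots> \<longleftrightarrow> 0 \<le> R l \<omega> j \<and> (j = 0 \<or> R l \<omega> (j - 1) < 0)"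
      using elim by (auto simp: not_le)
    finally show ?case unfolding I_def S by (simp add: indicator_def)
  qed
  \<comment> \<open>With \<open>j\<close> fixed the ascent positions \<open>B j\<close> no longer
    depend on the path, so \<open>expectation_mult_Omega\<close> factors the two blocks.\<close>
  have summand: "Omega.expectation (\<lambda>\<omega>. indicator {\<omega>. reversal_state l \<omega> = j} \<omega> * f (sqrt (U j \<omega> (Suc N0)))) =
    pN n N0 N1 v l j * OmegaE.expectation (\<lambda>E. f (sqrt (2 * expsum (tail_seq j lam) E)))" if j: "j \<le> N0" for j
  proof -
    \<comment> \<open>A descent position has coordinate sum \<open>N0 - 1\<close>, an ascent
      position \<open>N0 + 1 + 2 * (i - j)\<close>.\<close>
    have disj: "?D \<inter> B j = {}"
      by (auto simp: B_def up_clock_def)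
    have rv [measurable]: "(\<lambda>\<omega>. I j (\<lambda>p\<in>?D. \<omega> (fst p) (snd p))) \<in> borel_measurable Omega"
       "(\<lambda>\<omega>. f (W j (\<lambda>p\<in>B j. \<omega> (fst p) (snd p)))) \<in> borel_measurable Omega"
    proof -
      have "(\<lambda>\<omega>. \<lambda>p\<in>A. \<omega> (fst p) (snd p)) \<in> measurable Omega (PiM A (\<lambda>_. Exp1))" for A
        by (rule measurable_restrict) (simp cong: measurable_cong_sets add: measurable_Omega_component)
      from measurable_compose[OF this I_meas] measurable_compose[OF measurable_compose[OF this W_meas], of f borel]
      show "(\<lambda>\<omega>. I j (\<lambda>p\<in>?D. \<omega> (fst p) (snd p))) \<in> borel_measurable Omega"
       "(\<lambda>\<omega>. f (W j (\<lambda>p\<in>B j. \<omega> (fst p) (snd p)))) \<in> borel_measurable Omega" by simp_all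
    qed
    have ind [measurable]: "(\<lambda>\<omega>. indicator {\<omega>. reversal_state l \<omega> = j} \<omega> :: real) \<in> borel_measurable Omega"
    proof -
      have "{\<omega> \<in> space Omega. reversal_state l \<omega> = j} \<in> sets Omega" by measurable
      then show ?thesis by (intro borel_measurable_indicator) simp
    qed
    have "Omega.expectation (\<lambda>\<omega>. indicator {\<omega>. reversal_state l \<omega> = j} \<omega> * f (sqrt (U j \<omega> (Suc N0)))) =
      Omega.expectation (\<lambda>\<omega>. I j (\<lambda>p\<in>?D. \<omega> (fst p) (snd p)) * f (W j (\<lambda>p\<in>B j. \<omega> (fst p) (snd p))))"
      using I_AE[of j]
    proof (intro integral_cong_AE)
      show "(\<lambda>\<omega>. indicator {\<omega>. reversal_state l \<omega> = j} \<omega> * f (sqrt (U j \<omega> (Suc N0)))) \<in> borel_measurable Omega"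
        using ind rv(2) unfolding W by (rule borel_measurable_times)
      show "(\<lambda>\<omega>. I j (\<lambda>p\<in>?D. \<omega> (fst p) (snd p)) * f (W j (\<lambda>p\<in>B j. \<omega> (fst p) (snd p)))) \<in> borel_measurable Omega"
        using rv by (rule borel_measurable_times)
      show "AE \<omega> in Omega. indicator {\<omega>. reversal_state l \<omega> = j} \<omega> * f (sqrt (U j \<omega> (Suc N0))) =
        I j (\<lambda>p\<in>?D. \<omega> (fst p) (snd p)) * f (W j (\<lambda>p\<in>B j. \<omega> (fst p) (snd p)))"
        using I_AE[of j] by eventually_elim (simp add: W)
    qed
    also have "\<dots> = Omega.expectation (\<lambda>\<omega>. I j (\<lambda>p\<in>?D. \<omega> (fst p) (snd p))) *
        Omega.expectation (\<lambda>\<omega>. f (W j (\<lambda>p\<in>B j. \<omega> (fst p) (snd p))))"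
    proof (rule expectation_mult_Omega[where f="I j" and g="\<lambda>p. f (W j p)" and C=1, OF disj I_meas])
      show "(\<lambda>p. f (W j p)) \<in> borel_measurable (PiM (B j) (\<lambda>_. Exp1))"
        by (rule measurable_compose[OF W_meas]) measurable
    qed (use bound in \<open>auto simp: I_def\<close>)
    also have "Omega.expectation (\<lambda>\<omega>. I j (\<lambda>p\<in>?D. \<omega> (fst p) (snd p))) = pN n N0 N1 v l j"
    proof -
      have "Omega.expectation (\<lambda>\<omega>. I j (\<lambda>p\<in>?D. \<omega> (fst p) (snd p))) =
          Omega.expectation (indicator {\<omega>. reversal_state l \<omega> = j})"
        by (rule integral_cong_AE[OF rv(1) ind]) (use I_AE[of j] in \<open>eventually_elim, simp\<close>)
      also have "\<dots> = pN n N0 N1 v l j" by (simp add: pN_def)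
      finally show ?thesis .
    qed
    also have "Omega.expectation (\<lambda>\<omega>. f (W j (\<lambda>p\<in>B j. \<omega> (fst p) (snd p)))) =
        OmegaE.expectation (\<lambda>E. f (sqrt (2 * expsum (tail_seq j lam) E)))"
    proof -
      have "OmegaE.expectation (\<lambda>E. f (sqrt (2 * expsum (tail_seq j lam) E))) =
        integral\<^sup>L (distr Omega OmegaE (?up j)) (\<lambda>E. f (sqrt (2 * expsum (tail_seq j lam) E)))"
        by (simp only: distr_Omega_select[OF inj_up_clock[OF j]])
      also have "\<dots> = Omega.expectation (\<lambda>\<omega>. f (sqrt (2 * expsum (tail_seq j lam) (?up j \<omega>))))"
        by (rule integral_distr[OF measurable_Omega_select]) measurable
      finally show ?thesis by (simp add: W U_eq_expsum)
    qed
    finally show ?thesis .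
  qed
  have int: "integrable Omega (\<lambda>\<omega>. indicator {\<omega>. reversal_state l \<omega> = j} \<omega> * f (sqrt (U j \<omega> (Suc N0))))" if "j \<le> N0" for j
  proof (rule Omega.integrable_const_bound[of _ 1])
    have "(\<lambda>\<omega>. f (sqrt (2 * expsum (tail_seq j lam) (?up j \<omega>)))) \<in> borel_measurable Omega"
      by (rule measurable_compose[OF measurable_Omega_select]) measurable
    moreover have "{\<omega> \<in> space Omega. reversal_state l \<omega> = j} \<in> sets Omega" by measurable
    ultimately show "(\<lambda>\<omega>. indicator {\<omega>. reversal_state l \<omega> = j} \<omega> * f (sqrt (U j \<omega> (Suc N0)))) \<in> borel_measurable Omega"
      unfolding U_eq_expsum by (intro borel_measurable_times borel_measurable_indicator) simp_all
  qed (use bound in \<open>auto simp: indicator_def\<close>)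
  \<comment> \<open>Almost surely exactly one index matches the reversal state, and it is at most
    \<open>N0\<close>.\<close>
  have "Omega.expectation (\<lambda>\<omega>. f (exit_memory l \<omega>)) =
    Omega.expectation (\<lambda>\<omega>. \<Sum>j\<le>N0. indicator {\<omega>. reversal_state l \<omega> = j} \<omega> * f (sqrt (U j \<omega> (Suc N0))))"
  proof (rule integral_cong_AE)
    show "(\<lambda>\<omega>. f (exit_memory l \<omega>)) \<in> borel_measurable Omega"
      by (rule measurable_compose[OF measurable_exit_memory]) measurable
    show "(\<lambda>\<omega>. \<Sum>j\<le>N0. indicator {\<omega>. reversal_state l \<omega> = j} \<omega> * f (sqrt (U j \<omega> (Suc N0)))) \<in> borel_measurable Omega"
      using int by (intro borel_measurable_sum) (auto intro: borel_measurable_integrable)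
    show "AE \<omega> in Omega. f (exit_memory l \<omega>) = (\<Sum>j\<le>N0. indicator {\<omega>. reversal_state l \<omega> = j} \<omega> * f (sqrt (U j \<omega> (Suc N0))))"
      using AE_reversal_and_exit[OF l]
    proof eventually_elim
      case (elim \<omega>)
      have "(\<Sum>j\<le>N0. indicator {\<omega>. reversal_state l \<omega> = j} \<omega> * f (sqrt (U j \<omega> (Suc N0)))) =
         (\<Sum>j\<le>N0. if j = reversal_state l \<omega> then f (sqrt (U j \<omega> (Suc N0))) else 0)"
        by (intro sum.cong) (auto simp: indicator_def)
      also have "\<dots> = f (exit_memory l \<omega>)"
        using elim by (subst sum.delta) auto
      finally show ?case by simp
    qed
  qed
  also have "\<dots> = (\<Sum>j\<le>N0. pN n N0 N1 v l j * OmegaE.expectation (\<lambda>E. f (sqrt (2 * expsum (tail_seq j lam) E))))"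
    using int by (subst Bochner_Integration.integral_sum) (auto intro!: sum.cong summand)
  finally have "Omega.expectation (\<lambda>\<omega>. f (exit_memory l \<omega>)) =
    (\<Sum>j\<le>N0. pN n N0 N1 v l j * OmegaE.expectation (\<lambda>E. f (sqrt (2 * expsum (tail_seq j lam) E))))" .
  moreover have "pN n N0 N1 v l j = 0" if "j \<notin> {..N0}" for j
  proof -
    have "AE \<omega> in Omega. \<not> (reversal_state l \<omega> = j)"
      using AE_reversal_and_exit[OF l] by eventually_elim (use that in auto)
    moreover have "{\<omega> \<in> space Omega. reversal_state l \<omega> = j} \<in> sets Omega" by measurable
    ultimately show ?thesis
      unfolding pN_def by (subst Omega.prob_eq_0) simp_all
  qed
  ultimately show ?thesis
    by (simp only:) (rule sums_finite, auto)
qed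

end

section \<open>The limit\<close>

lemma suminf_tail_seq_diff_tendsto_0:
  assumes a: "\<And>n. summable (\<lambda>i. \<bar>a n i\<bar>)" and b: "summable (\<lambda>i. \<bar>b i\<bar>)"
    and lim: "(\<lambda>n. \<Sum>i. \<bar>a n i - b i\<bar>) \<longlonglongrightarrow> 0"
  shows "(\<lambda>n. \<Sum>i. \<bar>tail_seq j (a n) i - tail_seq j b i\<bar>) \<longlonglongrightarrow> 0"
proof (rule tendsto_sandwich[OF _ _ tendsto_const lim])
  have ab: "summable (\<lambda>i. \<bar>a n i - b i\<bar>)" for n
    by (rule summable_comparison_test[OF _ summable_add[OF a[of n] b]]) (auto intro!: exI[of _ 0])
  show "\<forall>\<^sub>F n in sequentially. (\<Sum>i. \<bar>tail_seq j (a n) i - tail_seq j b i\<bar>) \<le> (\<Sum>i. \<bar>a n i - b i\<bar>)"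
    by (intro always_eventually allI suminf_tail_seq_diff_le ab)
  have "summable (\<lambda>i. \<bar>tail_seq j (a n) i - tail_seq j b i\<bar>)" for n
    by (rule summable_comparison_test[OF _ ab[of n]]) (auto simp: tail_seq_def)
  then show "\<forall>\<^sub>F n in sequentially. 0 \<le> (\<Sum>i. \<bar>tail_seq j (a n) i - tail_seq j b i\<bar>)"
    by (intro always_eventually allI suminf_nonneg) auto
qed

text \<open>No mass escapes since the limit weights sum to \<open>1\<close>.\<close>
lemma suminf_weighted_tendsto:
  fixes p g :: "nat \<Rightarrow> nat \<Rightarrow> real"
  assumes p: "\<And>n. p n sums 1" "\<And>n j. 0 \<le> p n j" and q: "q sums 1"
    and pq: "\<And>j. (\<lambda>n. p n j) \<longlonglongrightarrow> q j"
    and g: "\<And>n j. \<bar>g n j\<bar> \<le> 1" and gh: "\<And>j. (\<lambda>n. g n j) \<longlonglongrightarrow> h j"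
  shows "(\<lambda>n. \<Sum>j. p n j * g n j) \<longlonglongrightarrow> (\<Sum>j. q j * h j)"
proof (rule LIMSEQ_I)
  \<comment> \<open>Beyond \<open>J\<close> the weights have mass 1 minus their partial sum, which
    bounds the neglected part for every \<open>f\<close> bounded by 1.\<close>
  have tail: "\<bar>(\<Sum>j. r j * f j) - (\<Sum>j<J. r j * f j)\<bar> \<le> 1 - (\<Sum>j<J. r j)"
    if r: "r sums 1" "\<And>j. 0 \<le> r j" and f: "\<And>j. \<bar>f j\<bar> \<le> 1" for r f :: "nat \<Rightarrow> real" and J
  proof -
    have le: "\<bar>r j * f j\<bar> \<le> r j" for j
      using mult_left_mono[OF f[of j] r(2)[of j]] r(2)[of j] by (simp add: abs_mult)
    have sr: "summable r" using r(1) by (rule sums_summable)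
    have sa: "summable (\<lambda>j. \<bar>r j * f j\<bar>)"
      by (rule summable_comparison_test[OF _ sr]) (use le in auto)
    have sr': "summable (\<lambda>j. r (j + J))" and sa': "summable (\<lambda>j. \<bar>r (j + J) * f (j + J)\<bar>)"
      using sr sa by (simp_all add: summable_iff_shift[of r J] summable_iff_shift[of "\<lambda>j. \<bar>r j * f j\<bar>" J])
    have "(\<Sum>j. r j * f j) - (\<Sum>j<J. r j * f j) = (\<Sum>j. r (j + J) * f (j + J))"
      by (rule suminf_minus_initial_segment[symmetric, OF summable_rabs_cancel[OF sa]])
    also have "\<bar>\<dots>\<bar> \<le> (\<Sum>j. \<bar>r (j + J) * f (j + J)\<bar>)"
      by (rule summable_rabs[OF sa'])
    also have "\<dots> \<le> (\<Sum>j. r (j + J))"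
      by (rule suminf_le[OF le sa' sr'])
    also have "\<dots> = 1 - (\<Sum>j<J. r j)"
      using suminf_minus_initial_segment[OF sr, of J] sums_unique[OF r(1)] by simp
    finally show ?thesis .
  qed
  have q0: "0 \<le> q j" for j
    using pq[of j] by (rule LIMSEQ_le_const) (use p(2) in auto)
  have h1: "\<bar>h j\<bar> \<le> 1" for j
    using tendsto_rabs[OF gh[of j]] by (rule LIMSEQ_le_const2) (use g in auto)
  fix e :: real assume e: "0 < e"
  \<comment> \<open>\<open>J\<close> is chosen from \<open>q\<close> alone; convergence of finitely
    many weights passes its bound on to \<open>p n\<close> for large \<open>n\<close>. The three
    errors are the tail under \<open>p n\<close>, the tail under \<open>q\<close> and the finite
    part.\<close>
  have "\<forall>\<^sub>F J in sequentially. 1 - e / 3 < (\<Sum>j<J. q j)"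
    using q e unfolding sums_def by (intro order_tendstoD(1)) auto
  then obtain J where J: "1 - e / 3 < (\<Sum>j<J. q j)"
    using eventually_happens[of _ sequentially] by auto
  have 1: "\<forall>\<^sub>F n in sequentially. 1 - e / 3 < (\<Sum>j<J. p n j)"
    using J by (intro order_tendstoD(1)[OF tendsto_sum[OF pq]])
  have "(\<lambda>n. \<bar>(\<Sum>j<J. p n j * g n j) - (\<Sum>j<J. q j * h j)\<bar>) \<longlonglongrightarrow> \<bar>(\<Sum>j<J. q j * h j) - (\<Sum>j<J. q j * h j)\<bar>"
    by (intro tendsto_rabs tendsto_diff tendsto_sum tendsto_mult pq gh tendsto_const)
  then have 2: "\<forall>\<^sub>F n in sequentially. \<bar>(\<Sum>j<J. p n j * g n j) - (\<Sum>j<J. q j * h j)\<bar> < e / 3"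
    using e by (intro order_tendstoD(2)) auto
  from 1 2 have "\<forall>\<^sub>F n in sequentially. \<bar>(\<Sum>j. p n j * g n j) - (\<Sum>j. q j * h j)\<bar> < e"
  proof eventually_elim
    case (elim n)
    then show ?case
      using tail[of "p n" "g n" J, OF p g] tail[of q h J, OF q q0 h1] J by linarith
  qed
  then show "\<exists>no. \<forall>n\<ge>no. norm ((\<Sum>j. p n j * g n j) - (\<Sum>j. q j * h j)) < e"
    by (simp add: eventually_sequentially)
qed

text \<open>\<open>sqrt\<close> is odd on the real line, and a weighted sum with arbitrary
  coefficients may be negative, so test functions must be uniformly continuous everywhere.
  Increments are at most \<open>2 * sqrt |x - y|\<close>; the factor 2 arises when 0 lies between
  the two points.\<close>

lemma uniformly_continuous_sqrt: "uniformly_continuous_on UNIV sqrt"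
  unfolding uniformly_continuous_on_def
proof (intro allI impI)
  fix e :: real assume e: "0 < e"
  have le: "\<bar>sqrt x - sqrt y\<bar> \<le> 2 * sqrt \<bar>x - y\<bar>" for x y
  proof -
    have aux: "sqrt b - sqrt a \<le> 2 * sqrt (b - a)" if ab: "a \<le> b" for a b :: real
    proof -
      have nonneg: "0 \<le> sqrt (b - a)" using ab by simp
      consider "0 \<le> a" | "a < 0" "0 \<le> b" | "b < 0" using ab by linarith
      then show ?thesis
      proof cases
        case 1
        then have "sqrt b \<le> sqrt a + sqrt (b - a)"
          using sqrt_add_le_add_sqrt[of a "b - a"] ab by simp
        with nonneg show ?thesis by linarith
      next
        case 2
        then have "sqrt b \<le> sqrt (b - a)" "sqrt (- a) \<le> sqrt (b - a)" by simp_all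
        then show ?thesis unfolding real_sqrt_minus by linarith
      next
        case 3
        then have "sqrt (- a) \<le> sqrt (- b) + sqrt (b - a)"
          using sqrt_add_le_add_sqrt[of "- b" "b - a"] ab by simp
        with nonneg show ?thesis unfolding real_sqrt_minus by linarith
      qed
    qed
    show ?thesis
      using aux[of x y] aux[of y x] by (cases "x \<le> y") (auto simp: abs_if)
  qed
  show "\<exists>d>0. \<forall>x\<in>UNIV. \<forall>x'\<in>UNIV. dist x' x < d \<longrightarrow> dist (sqrt x') (sqrt x) < e"
  proof (intro exI[of _ "(e / 2)\<^sup>2"] conjI ballI impI)
    show "0 < (e / 2)\<^sup>2" using e by simp
    fix x x' :: real assume "dist x' x < (e / 2)\<^sup>2"
    then have "sqrt \<bar>x' - x\<bar> < e / 2"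
      using e by (intro real_less_lsqrt) (auto simp: dist_real_def)
    then show "dist (sqrt x') (sqrt x) < e"
      using le[of x' x] by (simp add: dist_real_def)
  qed
qed

lemma abs_expectation_le_1:
  assumes "\<And>x. \<bar>f x :: real\<bar> \<le> 1"
  shows "\<bar>OmegaE.expectation (\<lambda>E. f (X E))\<bar> \<le> 1"
proof (cases "integrable OmegaE (\<lambda>E. f (X E))")
  case True
  have "\<bar>OmegaE.expectation (\<lambda>E. f (X E))\<bar> \<le> OmegaE.expectation (\<lambda>E. \<bar>f (X E)\<bar>)"
    by (rule integral_abs_bound)
  also have "\<dots> \<le> OmegaE.expectation (\<lambda>_. 1)"
    using True assms by (intro integral_mono) auto
  finally show ?thesis using OmegaE.prob_space by simp
qed (simp add: not_integrable_integral_eq)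

lemma integral_nat_pmf_sums:
  fixes f :: "nat \<Rightarrow> real"
  assumes "\<And>j. \<bar>f j\<bar> \<le> 1"
  shows "(\<lambda>j. pmf Z j * f j) sums (LINT j|measure_pmf Z. f j)"
proof -
  have "integrable (measure_pmf Z) f"
    by (rule measure_pmf.integrable_const_bound[of _ 1]) (use assms in auto)
  then have "integrable (count_space UNIV) (\<lambda>j. pmf Z j *\<^sub>R f j)"
    unfolding measure_pmf_eq_density by (subst (asm) integrable_density) auto
  moreover have "(LINT j|measure_pmf Z. f j) = (LINT j|count_space UNIV. pmf Z j *\<^sub>R f j)"
    unfolding measure_pmf_eq_density by (rule integral_density) auto
  ultimately show ?thesis
    using sums_integral_count_space_nat[of "\<lambda>j. pmf Z j *\<^sub>R f j"] by simp
qed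

lemma ex_nat_pmf:
  assumes "\<And>j. 0 \<le> p j" "p sums 1"
  shows "\<exists>Z :: nat pmf. \<forall>j. pmf Z j = p j"
proof -
  have "(\<integral>\<^sup>+j. ennreal (p j) \<partial>count_space UNIV) = 1"
    using suminf_ennreal_eq[OF assms] by (simp add: nn_integral_count_space_nat)
  then show ?thesis
    using pmf_embed_pmf[of p] assms(1) by (intro exI[of _ "embed_pmf p"]) auto
qed

text \<open>The sum over \<open>j\<close> in \<open>F\<close> has the single nonzero term \<open>j = z\<close>.\<close>
lemma integral_mixture:
  fixes f :: "real \<Rightarrow> real"
  assumes b: "summable (\<lambda>i. \<bar>b i\<bar>)" and f [measurable]: "f \<in> borel_measurable borel" and bound: "\<And>x. \<bar>f x\<bar> \<le> 1"
  defines "F \<equiv> \<lambda>(E, z). \<Sum>j. sqrt (2 * (\<Sum>i. b (i + j) * E (i + j))) * indicator {z :: nat} j"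
  shows "F \<in> borel_measurable (OmegaE \<Otimes>\<^sub>M measure_pmf Z)"
    and "integral\<^sup>L (distr (OmegaE \<Otimes>\<^sub>M measure_pmf Z) borel F) f =
      (\<Sum>j. pmf Z j * OmegaE.expectation (\<lambda>E. f (sqrt (2 * expsum (tail_seq j b) E))))"
proof -
  have F_eq: "F = (\<lambda>p. sqrt (2 * (\<Sum>i. b (i + snd p) * fst p (i + snd p))))"
  proof
    fix p :: "(nat \<Rightarrow> real) \<times> nat"
    have "(\<Sum>j. sqrt (2 * (\<Sum>i. b (i + j) * fst p (i + j))) * indicator {snd p} j) =
      (\<Sum>j\<in>{snd p}. sqrt (2 * (\<Sum>i. b (i + j) * fst p (i + j))) * indicator {snd p} j)"
      by (rule suminf_finite) auto
    then show "F p = sqrt (2 * (\<Sum>i. b (i + snd p) * fst p (i + snd p)))"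
      by (simp add: F_def split_beta)
  qed
  show F: "F \<in> borel_measurable (OmegaE \<Otimes>\<^sub>M measure_pmf Z)"
    unfolding F_eq
  proof (rule measurable_compose_countable)
    show "(\<lambda>p. sqrt (2 * (\<Sum>i. b (i + j) * fst p (i + j)))) \<in> borel_measurable (OmegaE \<Otimes>\<^sub>M measure_pmf Z)" for j
    proof (rule measurable_compose[OF measurable_fst])
      show "(\<lambda>E. sqrt (2 * (\<Sum>i. b (i + j) * E (i + j)))) \<in> borel_measurable OmegaE"
        by measurable
    qed
    show "snd \<in> measurable (OmegaE \<Otimes>\<^sub>M measure_pmf Z) (count_space UNIV)"
      using measurable_snd[of OmegaE "measure_pmf Z"] by (simp cong: measurable_cong_sets)
  qed
  interpret pair_sigma_finite OmegaE "measure_pmf Z" ..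
  interpret P: pair_prob_space OmegaE "measure_pmf Z" ..
  have meas: "(\<lambda>p. f (F p)) \<in> borel_measurable (OmegaE \<Otimes>\<^sub>M measure_pmf Z)"
    by (rule measurable_compose[OF F f])
  have int: "integrable (OmegaE \<Otimes>\<^sub>M measure_pmf Z) (\<lambda>p. f (F p))"
    by (rule P.integrable_const_bound[of _ 1]) (use bound meas in auto)
  have "integral\<^sup>L (distr (OmegaE \<Otimes>\<^sub>M measure_pmf Z) borel F) f = integral\<^sup>L (OmegaE \<Otimes>\<^sub>M measure_pmf Z) (\<lambda>p. f (F p))"
    by (rule integral_distr[OF F f])
  \<comment> \<open>Fubini with \<open>z\<close> outside freezes the tail index while the clocks are
    integrated.\<close>
  also have "\<dots> = (LINT z|measure_pmf Z. LINT E|OmegaE. f (F (E, z)))"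
    using integral_snd[of "\<lambda>E z. f (F (E, z))"] int by (simp add: split_beta')
  also have "\<dots> = (LINT z|measure_pmf Z. OmegaE.expectation (\<lambda>E. f (sqrt (2 * expsum (tail_seq z b) E))))"
  proof (rule Bochner_Integration.integral_cong[OF refl])
    fix z
    show "(LINT E|OmegaE. f (F (E, z))) = OmegaE.expectation (\<lambda>E. f (sqrt (2 * expsum (tail_seq z b) E)))"
    \<comment> \<open>The shifted series is identified with \<open>expsum\<close> of the tail only
      where it converges absolutely, hence almost surely.\<close>
    proof (rule integral_cong_AE)
      show "(\<lambda>E. f (F (E, z))) \<in> borel_measurable OmegaE"
        unfolding F_eq by simp
      show "AE E in OmegaE. f (F (E, z)) = f (sqrt (2 * expsum (tail_seq z b) E))"
        using AE_summable_OmegaE[OF b] by eventually_elim (simp add: F_eq expsum_tail_seq)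
    qed measurable
  qed
  also have "\<dots> = (\<Sum>j. pmf Z j * OmegaE.expectation (\<lambda>E. f (sqrt (2 * expsum (tail_seq j b) E))))"
  proof (rule sums_unique[OF integral_nat_pmf_sums])
    show "\<bar>OmegaE.expectation (\<lambda>E. f (sqrt (2 * expsum (tail_seq j b) E)))\<bar> \<le> 1" for j
      by (rule abs_expectation_le_1[OF bound])
  qed
  finally show "integral\<^sup>L (distr (OmegaE \<Otimes>\<^sub>M measure_pmf Z) borel F) f =
      (\<Sum>j. pmf Z j * OmegaE.expectation (\<lambda>E. f (sqrt (2 * expsum (tail_seq j b) E))))" .
qed

theorem mainTheorem10:
  fixes N0 N1 :: "nat \<Rightarrow> nat" and v :: "nat \<Rightarrow> nat \<Rightarrow> real"
    and mu lam :: "nat \<Rightarrow> real" and ls :: "nat \<Rightarrow> real" and l :: real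
  assumes layers: "\<forall>n\<ge>2. 2 * N0 n < n \<and> 2 * N1 n < n"
    and N0_small: "(\<lambda>n. real (N0 n) / real n) \<longlonglongrightarrow> 0"
    and N1_small: "(\<lambda>n. real (N1 n) / real n) \<longlonglongrightarrow> 0"
    and v_pos: "\<forall>n\<ge>2. \<forall>j\<le>N0 n. 0 < v n j"
    and v_neg: "\<forall>n\<ge>2. \<forall>j. n - N1 n \<le> j \<and> j \<le> n \<longrightarrow> v n j < 0"
    and v_zero: "\<forall>n\<ge>2. \<forall>j. N0 n < j \<and> j < n - N1 n \<longrightarrow> v n j = 0"
    and v_sum0: "\<forall>n\<ge>2. (\<Sum>j\<le>N0 n. v n j) = real n"
    and v_sum1: "\<forall>n\<ge>2. (\<Sum>j\<le>N1 n. \<bar>v n (n - j)\<bar>) = real n"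
    and N0_inf: "filterlim N0 at_top sequentially"
    and G1: "summable (\<lambda>j. \<bar>mu j\<bar>)"
      "(\<lambda>n. \<Sum>j. \<bar>muN n (N0 n) (N1 n) (v n) j - mu j\<bar>) \<longlonglongrightarrow> 0"
    and G2: "summable (\<lambda>j. \<bar>lam j\<bar>)"
      "(\<lambda>n. \<Sum>j. \<bar>lamN n (N0 n) (N1 n) (v n) j - lam j\<bar>) \<longlonglongrightarrow> 0"
    and ls_neg: "\<forall>n. ls n < 0"
    and ls_lim: "ls \<longlonglongrightarrow> l"
    and l_neg: "l < 0"
  shows "\<exists>Z :: nat pmf.
     (\<forall>j. (\<lambda>n. pN n (N0 n) (N1 n) (v n) (ls n) j) \<longlonglongrightarrow> pmf Z j) \<and>
     weak_conv_m (\<lambda>n. VN n (N0 n) (N1 n) (v n) (ls n))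
       (distr (OmegaE \<Otimes>\<^sub>M measure_pmf Z) borel
          (\<lambda>(E, z). \<Sum>j. sqrt (2 * (\<Sum>i. lam (i + j) * E (i + j))) * indicator {z} j))"
proof -
  \<comment> \<open>The model is assumed for \<open>n \<ge> 2\<close>, so every sequence is shifted
    by 2; \<open>LIMSEQ_offset\<close> undoes this at the end.\<close>
  have layer: "lower_layer (n + 2) (N0 (n + 2)) (v (n + 2))" for n
    using layers[rule_format, of "n + 2"] v_pos[rule_format, of "n + 2"] by unfold_locales auto
  define \<mu> where "\<mu> n = muN (n + 2) (N0 (n + 2)) (N1 (n + 2)) (v (n + 2))" for n
  define \<Lambda> where "\<Lambda> n = lamN (n + 2) (N0 (n + 2)) (N1 (n + 2)) (v (n + 2))" for n
  define p where "p n = pN (n + 2) (N0 (n + 2)) (N1 (n + 2)) (v (n + 2)) (ls (n + 2))" for n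
  define V where "V n = VN (n + 2) (N0 (n + 2)) (N1 (n + 2)) (v (n + 2)) (ls (n + 2))" for n
  define Q where "Q b c j = OmegaE.prob {E. expsum (tail_seq j b) E \<le> c\<^sup>2 / 2}" for b c j
  define q where "q j = Q mu l j - (if j = 0 then 0 else Q mu l (j - 1))" for j
  have \<mu>: "summable (\<lambda>j. \<bar>\<mu> n j\<bar>)" "(\<lambda>n. \<Sum>j. \<bar>\<mu> n j - mu j\<bar>) \<longlonglongrightarrow> 0" for n
    unfolding \<mu>_def using lower_layer.summable_mu[OF layer] LIMSEQ_ignore_initial_segment[OF G1(2), of 2] by auto
  have \<Lambda>: "summable (\<lambda>j. \<bar>\<Lambda> n j\<bar>)" "(\<lambda>n. \<Sum>j. \<bar>\<Lambda> n j - lam j\<bar>) \<longlonglongrightarrow> 0" for n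
    unfolding \<Lambda>_def using lower_layer.summable_lam[OF layer] LIMSEQ_ignore_initial_segment[OF G2(2), of 2] by auto
  have ls: "(\<lambda>n. ls (n + 2)) \<longlonglongrightarrow> l"
    by (rule LIMSEQ_ignore_initial_segment[OF ls_lim])
  have p_eq: "p n j = Q (\<mu> n) (ls (n + 2)) j - (if j = 0 then 0 else Q (\<mu> n) (ls (n + 2)) (j - 1))" for n j
    unfolding p_def Q_def \<mu>_def by (rule lower_layer.pN_eq[OF layer ls_neg[rule_format]])
  have Q_lim: "(\<lambda>n. Q (\<mu> n) (ls (n + 2)) j) \<longlonglongrightarrow> Q mu l j" for j
    unfolding Q_def
  proof (rule prob_expsum_le_tendsto)
    show "(\<lambda>n. (ls (n + 2))\<^sup>2 / 2) \<longlonglongrightarrow> l\<^sup>2 / 2"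
      by (intro tendsto_intros ls) simp
  qed (use l_neg in \<open>auto intro!: summable_tail_seq suminf_tail_seq_diff_tendsto_0 \<mu> G1\<close>)
  have p_lim: "(\<lambda>n. p n j) \<longlonglongrightarrow> q j" for j
    unfolding p_eq q_def
    by (intro tendsto_diff Q_lim) (cases "j = 0"; simp only: simp_thms if_True if_False tendsto_const Q_lim)
  have p_nonneg: "0 \<le> p n j" for n j
    unfolding p_def by (rule lower_layer.pN_nonneg[OF layer])
  have q_nonneg: "0 \<le> q j" for j
    using p_lim by (rule LIMSEQ_le_const) (use p_nonneg in auto)
  have V_sums: "(\<lambda>j. p n j * OmegaE.expectation (\<lambda>E. f (sqrt (2 * expsum (tail_seq j (\<Lambda> n)) E)))) sums integral\<^sup>L (V n) f"
    if f: "f \<in> borel_measurable borel" "\<And>x. \<bar>f x\<bar> \<le> 1" for f :: "real \<Rightarrow> real" and n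
    unfolding p_def \<Lambda>_def V_def VN_def
    using lower_layer.expectation_exit_memory[OF layer ls_neg[rule_format] f]
    by (subst integral_distr[OF lower_layer.measurable_exit_memory[OF layer] f(1)])
  have V_dist: "real_distribution (V n)" for n
    unfolding V_def VN_def by (rule Omega.real_distribution_distr[OF lower_layer.measurable_exit_memory[OF layer]])
  have p_sums: "p n sums 1" for n
  proof -
    interpret V: real_distribution "V n" by (rule V_dist)
    \<comment> \<open>With the constant test function 1 every expectation becomes 1 and only the sum
      of the weights remains.\<close>
    from V_sums[of "\<lambda>_. 1" n] show ?thesis
      using V.prob_space OmegaE.prob_space by simp
  qed
  have q_sums: "q sums 1"
  proof -
    \<comment> \<open>\<open>prob_expsum_le_tendsto\<close> is reused with the tail index as the
      running index and zero coefficients in the limit; the degenerate sum 0 lies below the positive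
      threshold. The partial sums of \<open>q\<close> telescope to \<open>Q mu l\<close>.\<close>
    have "(\<lambda>j. Q mu l j) \<longlonglongrightarrow> OmegaE.prob {E. expsum (\<lambda>_. 0) E \<le> l\<^sup>2 / 2}"
      unfolding Q_def using suminf_tail_seq_tendsto_0[OF G1(1)] l_neg
      by (intro prob_expsum_le_tendsto summable_tail_seq[OF G1(1)] tendsto_const) auto
    moreover have "OmegaE.prob {E. expsum (\<lambda>_. 0) E \<le> l\<^sup>2 / 2} = 1"
      using OmegaE.prob_space by (simp add: expsum_def)
    moreover have "(\<Sum>j<Suc k. q j) = Q mu l k" for k
      by (induction k) (simp_all add: q_def)
    ultimately have "(\<lambda>k. \<Sum>j<Suc k. q j) \<longlonglongrightarrow> 1" by simp
    then show ?thesis unfolding sums_def by (rule LIMSEQ_imp_Suc)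
  qed
  obtain Z :: "nat pmf" where Z: "\<And>j. pmf Z j = q j"
    using ex_nat_pmf[OF q_nonneg q_sums] by auto
  let ?F = "\<lambda>(E, z). \<Sum>j. sqrt (2 * (\<Sum>i. lam (i + j) * E (i + j))) * indicator {z :: nat} j"
  let ?W = "distr (OmegaE \<Otimes>\<^sub>M measure_pmf Z) borel ?F"
  interpret P: pair_prob_space OmegaE "measure_pmf Z" ..
  have "weak_conv_m V ?W"
  proof (rule integral_cts_step_conv_imp_weak_conv[OF V_dist])
    show "real_distribution ?W"
      \<comment> \<open>The measurability part of \<open>integral_mixture\<close> shares the
        hypotheses on a test function, which the zero function satisfies.\<close>
      by (intro P.real_distribution_distr integral_mixture(1)[OF G2(1), of "\<lambda>_. 0"]) auto
    fix x y :: real assume xy: "x < y"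
    let ?f = "cts_step x y"
    have unif: "uniformly_continuous_on UNIV ?f"
      by (rule cts_step_uniformly_continuous[OF xy])
    have f: "?f \<in> borel_measurable borel" "\<And>z. \<bar>?f z\<bar> \<le> 1"
      using unif xy by (auto intro!: borel_measurable_continuous_onI uniformly_continuous_imp_continuous simp: cts_step_def)
    have unif': "uniformly_continuous_on UNIV (\<lambda>z. ?f (sqrt (2 * z)))"
    proof -
      have subset: "uniformly_continuous_on A g" if "uniformly_continuous_on UNIV g" for A and g :: "real \<Rightarrow> real"
        using that unfolding uniformly_continuous_on_def by (metis UNIV_I)
      have "uniformly_continuous_on UNIV (\<lambda>z::real. 2 * z)"
        by (intro bounded_linear.uniformly_continuous_on[OF bounded_linear_mult_right] uniformly_continuous_on_id)
      then have "uniformly_continuous_on UNIV (\<lambda>z. sqrt (2 * z))"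
        by (rule uniformly_continuous_on_compose) (rule subset[OF uniformly_continuous_sqrt])
      then show ?thesis
        by (rule uniformly_continuous_on_compose) (rule subset[OF unif])
    qed
    let ?g = "\<lambda>b j. OmegaE.expectation (\<lambda>E. ?f (sqrt (2 * expsum (tail_seq j b) E)))"
    have "(\<lambda>n. \<Sum>j. p n j * ?g (\<Lambda> n) j) \<longlonglongrightarrow> (\<Sum>j. q j * ?g lam j)"
    proof (rule suminf_weighted_tendsto[OF p_sums p_nonneg q_sums p_lim])
      show "\<bar>?g (\<Lambda> n) j\<bar> \<le> 1" for n j
        by (rule abs_expectation_le_1[OF f(2)])
      show "(\<lambda>n. ?g (\<Lambda> n) j) \<longlonglongrightarrow> ?g lam j" for j
        by (rule expectation_expsum_tendsto[OF summable_tail_seq[OF \<Lambda>(1)] summable_tail_seq[OF G2(1)]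
              suminf_tail_seq_diff_tendsto_0[OF \<Lambda>(1) G2(1) \<Lambda>(2)] unif' f(2)])
    qed
    then show "(\<lambda>n. integral\<^sup>L (V n) ?f) \<longlonglongrightarrow> integral\<^sup>L ?W ?f"
      using sums_unique[OF V_sums[OF f]] integral_mixture(2)[OF G2(1) f, of Z] by (simp add: Z)
  qed
  then have "weak_conv_m (\<lambda>n. VN n (N0 n) (N1 n) (v n) (ls n)) ?W"
    unfolding weak_conv_m_def weak_conv_def V_def by (auto intro: LIMSEQ_offset[of _ 2])
  moreover have "(\<lambda>n. pN n (N0 n) (N1 n) (v n) (ls n) j) \<longlonglongrightarrow> pmf Z j" for j
    using p_lim[of j] unfolding p_def Z by (rule LIMSEQ_offset)
  ultimately show ?thesis by auto
qed

end
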